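(* Let $X=\{X(t),\,t\ge0\}$ be a real-valued L\'evy process with characteristic triplet $(\gamma,\sigma,\Pi)$ such that $\beta^0<\beta^\infty$, and let $I=(\beta^0,\beta^\infty)$, where $\beta^0,\beta^\infty$ are the indices of $\Pi$ defined in the context. Let $s\ge0$. (i) If $\sigma=0$ and $\Pi\equiv0$, then as $t\to0$ $$t^{-q}\,\mathbb{E}|X(ts)|^q\to s^q|\gamma|^q\quad\text{for } q\in I.$$ (ii) If $\sigma\ne0$ and $\Pi\equiv0$, then as $t\to0$ $$t^{-\frac q2}\,\mathbb{E}|X(ts)|^q\to s^{\frac q2}\,\mathbb{E}|\mathcal{N}(0,\sigma^2)|^q\quad\text{for } q\in I.$$ (iii) If $\sigma=0$ and $\Pi\not\equiv0$, then as $t\to0$ $$t^{-1}\,\mathbb{E}|X(ts)|^q\to s\int_{\mathbb{R}}|x|^q\,\Pi(dx)\quad\text{for } q\in I\cap(1,\infty).$$ In case $\beta^0<1$: if $\gamma'=0$, where $\gamma'$ is the drift of $X$, then the convergence $t^{-1}\,\mathbb{E}|X(ts)|^q\to s\int_{\mathbb{R}}|x|^q\,\Pi(dx)$ holds also for $q\in I$ with $q\le1$; and if $\gamma'\ne0$, then as $t\to0$ $$t^{-q}\,\mathbb{E}|X(ts)|^q\to s^q|\gamma'|^q\quad\text{for } q\in I\cap(0,1).$$ (iv) If $\sigma\ne0$ and $\Pi\not\equiv0$, then as $t\to0$ $$\begin{cases}t^{-1}\,\mathbb{E}|X(ts)|^q\to s\int_{\mathbb{R}}|x|^q\,\Pi(dx),&\text{for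 } q\in I\cap(2,\infty),\\ t^{-1}\,\mathbb{E}|X(ts)|^q\to s\sigma^2+s\int_{\mathbb{R}}|x|^2\,\Pi(dx),&\text{for } q=2\text{ and } q\in I,\\ t^{-\frac q2}\,\mathbb{E}|X(ts)|^q\to s^{\frac q2}\,\mathbb{E}|\mathcal{N}(0,\sigma^2)|^q,&\text{for } q\in I\cap(0,2).\end{cases}$$
   Context: A real-valued L\'evy process $X$ has characteristic triplet $(\gamma,\sigma,\Pi)$ if $\mathbb{E}[e^{i\zeta X(t)}]=e^{t\Psi(\zeta)}$ for all $t\ge0$, $\zeta\in\mathbb{R}$, with $$\Psi(\zeta)=i\gamma\zeta-\frac{\sigma^2}{2}\zeta^2+\int_{\mathbb{R}}\left(e^{i\zeta x}-1-i\zeta x\mathbf{1}_{\{|x|\le1\}}\right)\Pi(dx),$$ where $\gamma\in\mathbb{R}$, $\sigma\ge 0$ and $\Pi$ is a measure on $\mathbb{R}\setminus\{0\}$ with $\int(1\wedge x^2)\,\Pi(dx)<\infty$. If $\int_{|x|\le1}|x|\,\Pi(dx)<\infty$ (in particular if $\beta^0<1$), then $\Psi$ may be written as $$\Psi(\zeta)=i\gamma'\zeta-\frac{\sigma^2}{2}\zeta^2+\int_{\mathbb{R}}\left(e^{i\zeta x}-1\right)\Pi(dx),$$ and $\gamma'=\gamma-\int_{|x|\le1}x\,\Pi(dx)$ is called the drift of $X$. Indices: $$\beta^0=\inf\left\{\beta\ge0:\int_{|x|\le1}|x|^\beta\,\Pi(dx)<\infty\right\}\in[0,2],\qquad \beta^\infty=\sup\left\{\beta\ge0:\int_{|x|>1}|x|^\beta\,\Pi(dx)<\infty\right\}\in[0,\infty].$$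 $\mathbb{E}|\mathcal{N}(0,\sigma^2)|^q$ denotes the $q$-th absolute moment of the normal distribution with mean $0$ and variance $\sigma^2$. *)

theory Defs
  imports "HOL-Probability.Probability"
begin

(* Instead of cadlag paths only stochastic continuity is required; every process with
   independent stationary increments and almost surely cadlag paths is covered. *)
locale levy_process = prob_space M for M :: "'a measure" +
  fixes X :: "real \<Rightarrow> 'a \<Rightarrow> real"
  assumes random_variable: "\<And>t. t \<ge> 0 \<Longrightarrow> X t \<in> borel_measurable M"
    and start_zero: "AE \<omega> in M. X 0 \<omega> = 0"
    and independent_increments:
      "\<And>(u :: nat \<Rightarrow> real) n. 0 \<le> u 0 \<Longrightarrow> (\<And>i. i < n \<Longrightarrow> u i \<le> u (Suc i)) \<Longrightarrow>
         indep_vars (\<lambda>_. borel) (\<lambda>i \<omega>. X (u (Suc i)) \<omega> - X (u i) \<omega>) {..<n}"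
    and stationary_increments:
      "\<And>t h. t \<ge> 0 \<Longrightarrow> h \<ge> 0 \<Longrightarrow>
         distr M borel (\<lambda>\<omega>. X (t + h) \<omega> - X t \<omega>) = distr M borel (X h)"
    and stochastic_continuity:
      "\<And>t e. t \<ge> 0 \<Longrightarrow> e > 0 \<Longrightarrow>
         ((\<lambda>u. prob {\<omega> \<in> space M. \<bar>X u \<omega> - X t \<omega>\<bar> > e}) \<longlongrightarrow> 0) (at t within {0..})"

(* A measure on the punctured line is encoded as a Borel measure on the line without
   an atom at 0. *)
definition levy_measure :: "real measure \<Rightarrow> bool" where
  "levy_measure \<nu> \<longleftrightarrow>
     sets \<nu> = sets borel \<and> emeasure \<nu> {0} = 0 \<and>
     (\<integral>\<^sup>+x. ennreal (min 1 (x\<^sup>2)) \<partial>\<nu>) < \<infinity>"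

definition levy_exponent :: "real \<Rightarrow> real \<Rightarrow> real measure \<Rightarrow> real \<Rightarrow> complex" where
  "levy_exponent \<gamma> \<sigma> \<nu> \<zeta> =
     \<i> * of_real (\<gamma> * \<zeta>) - of_real (\<sigma>\<^sup>2 / 2 * \<zeta>\<^sup>2) +
     (CLINT x|\<nu>. iexp (\<zeta> * x) - 1 - \<i> * of_real (\<zeta> * x * indicator {x. \<bar>x\<bar> \<le> 1} x))"

definition characteristic_triplet ::
  "'a measure \<Rightarrow> (real \<Rightarrow> 'a \<Rightarrow> real) \<Rightarrow> real \<Rightarrow> real \<Rightarrow> real measure \<Rightarrow> bool" where
  "characteristic_triplet M X \<gamma> \<sigma> \<nu> \<longleftrightarrow>
     \<sigma> \<ge> 0 \<and> levy_measure \<nu> \<and>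
     (\<forall>t\<ge>0. \<forall>\<zeta>. (CLINT \<omega>|M. iexp (\<zeta> * X t \<omega>)) = exp (of_real t * levy_exponent \<gamma> \<sigma> \<nu> \<zeta>))"

(* Meaningful only if x is integrable over [-1,1] with respect to \<nu>. *)
definition levy_drift :: "real \<Rightarrow> real measure \<Rightarrow> real" where
  "levy_drift \<gamma> \<nu> = \<gamma> - (LINT x:{x. \<bar>x\<bar> \<le> 1}|\<nu>. x)"

(* 0 powr 0 = 0 in Isabelle, so the integrand for \<beta> = 0 differs from 1 at x = 0 only,
   which is a null set of a Levy measure. *)
definition index_zero :: "real measure \<Rightarrow> ereal" where
  "index_zero \<nu> =
     Inf {ereal \<beta> | \<beta>. \<beta> \<ge> 0 \<and> (\<integral>\<^sup>+x\<in>{x. \<bar>x\<bar> \<le> 1}. ennreal (\<bar>x\<bar> powr \<beta>) \<partial>\<nu>) < \<infinity>}"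

definition index_infinity :: "real measure \<Rightarrow> ereal" where
  "index_infinity \<nu> =
     Sup {ereal \<beta> | \<beta>. \<beta> \<ge> 0 \<and> (\<integral>\<^sup>+x\<in>{x. \<bar>x\<bar> > 1}. ennreal (\<bar>x\<bar> powr \<beta>) \<partial>\<nu>) < \<infinity>}"

definition index_interval :: "real measure \<Rightarrow> real set" where
  "index_interval \<nu> = {q. index_zero \<nu> < ereal q \<and> ereal q < index_infinity \<nu>}"

(* Extended-valued: the Bochner integral would be 0 for an infinite moment. *)
definition abs_moment :: "'a measure \<Rightarrow> ('a \<Rightarrow> real) \<Rightarrow> real \<Rightarrow> ennreal" where
  "abs_moment M Y q = (\<integral>\<^sup>+\<omega>. ennreal (\<bar>Y \<omega>\<bar> powr q) \<partial>M)"

(* The density is that of N(0, \<sigma>^2) only for \<sigma> > 0. *)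
definition normal_abs_moment :: "real \<Rightarrow> real \<Rightarrow> ennreal" where
  "normal_abs_moment \<sigma> q =
     abs_moment (density lborel (\<lambda>x. ennreal (normal_density 0 \<sigma> x))) (\<lambda>x. x) q"

end

theory Submission
  imports Defs
begin

text \<open>
  The proof works with the characteristic function \<open>exp (t \<Psi>)\<close> of \<open>X t\<close> alone. For \<open>0 < q < 2k\<close> the substitution \<open>u \<mapsto> u / \<bar>x\<bar>\<close> shows that
  \<open>\<integral>\<^sub>0\<^sup>\<infinity> u powr (-1-q) sin (u x / 2) ^ (2k) du\<close> is a positive finite multiple of \<open>\<bar>x\<bar> powr q\<close>. Hence
  \<open>E \<bar>Y\<bar> powr q\<close> is, up to a constant that depends only on \<open>q\<close> and \<open>k\<close>, the integral of
  \<open>u powr (-1-q) E (sin (u Y / 2) ^ (2k))\<close>, and the same holds with the measure \<open>\<nu>\<close> in place of a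
  law. The functions \<open>sin (u x / 2) ^ (2k)\<close> are trigonometric polynomials in \<open>x\<close>, so their
  expectations are finite combinations of values of the characteristic function, and all limits
  become pointwise limits in \<open>u\<close> together with a dominating function that is integrable at \<open>0\<close> and at
  \<open>\<infinity>\<close> (\<open>tendsto_abs_moment\<close>).

  The domination for small \<open>u\<close> comes from the generator. On an exponential the generator acts as
  multiplication by \<open>\<Psi>\<close>, so that Dynkin's formula for trigonometric polynomials
  (\<open>dynkin_trig_poly\<close>) is the differentiation of \<open>exp (t \<Psi>)\<close> in \<open>t\<close>. As \<open>\<bar>sin\<bar>\<close> is subadditive, the
  generator maps \<open>f = sin (u x / 2) ^ (2k)\<close> to a function that is at most
  \<open>A f + B (u ^ (2k) + u powr r)\<close> whenever \<open>\<nu>\<close> integrates \<open>\<bar>x\<bar> powr r\<close> over the large jumps and \<open>r \<le> 2k\<close>,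
  and Gronwall's inequality turns this into \<open>E f (X t) \<le> C t (u ^ (2k) + u powr r)\<close>
  (\<open>sine_moment_le\<close>). For \<open>u \<ge> 1\<close> the estimate \<open>E f (X t) \<le> t \<bar>\<Psi> u\<bar>\<close> is used, where \<open>\<bar>\<Psi> u\<bar>\<close> grows at
  most like \<open>u powr p\<close> with \<open>p < q\<close> in the regimes where \<open>E \<bar>X t\<bar> powr q\<close> is of order \<open>t\<close>. For \<open>k \<ge> 2\<close>
  drift and Gaussian part are invisible to the generator of \<open>f\<close> at \<open>0\<close>, so that
  \<open>E f (X t) / t\<close> tends to \<open>\<integral> f d\<nu>\<close>, and the moment formula for \<open>\<nu>\<close> gives the limit
  \<open>\<integral> \<bar>x\<bar> powr q d\<nu>\<close> (\<open>moment_div_tendsto_jump_moment\<close>).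

  In the regimes dominated by drift or Gaussian part one takes \<open>k = 1\<close> and applies the same argument
  to \<open>X t / t\<close> or \<open>X t / sqrt t\<close>, whose characteristic functions converge to those of a point mass
  and of a normal law (\<open>scaled_moment_tendsto\<close>). The order \<open>q = 2\<close> is the borderline case in which
  jumps and Gaussian part contribute equally; there \<open>E (X t)\<^sup>2\<close> is recovered from
  \<open>4 E (sin (u X t / 2))\<^sup>2 / u\<^sup>2\<close> as \<open>u\<close> tends to \<open>0\<close> (\<open>second_moment_div_tendsto\<close>). Without jumps the law
  of \<open>X t\<close> is identified by the uniqueness theorem for characteristic functions.
\<close>

section \<open>Elementary inequalities\<close>

text \<open>The derivative of the exponential has modulus at most 1 on the left half-plane.\<close>

lemma norm_exp_minus_one_le:
  fixes z :: complex
  assumes "Re z \<le> 0"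
  shows "cmod (exp z - 1) \<le> cmod z"
proof -
  have "cmod (exp z - exp 0) \<le> 1 * cmod (z - 0)"
    by (rule field_differentiable_bound[where S = "{z. Re z \<le> 0}" and f' = exp])
       (use assms in \<open>auto intro: convex_halfspace_Re_le DERIV_exp DERIV_subset\<close>)
  then show ?thesis by simp
qed

lemma one_minus_Re_exp_le:
  assumes "Re z \<le> 0"
  shows "1 - Re (exp z) \<le> cmod z"
proof -
  have "1 - Re (exp z) = - Re (exp z - 1)" by simp
  also have "\<dots> \<le> cmod (exp z - 1)"
    using abs_Re_le_cmod[of "exp z - 1"] by linarith
  finally show ?thesis using norm_exp_minus_one_le[OF assms] by linarith
qed

text \<open>Here the imaginary part of \<open>z\<close> enters only quadratically. With \<open>z = t \<Psi> u\<close> this makes the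
  contribution of the drift to \<open>E (X t)\<^sup>2\<close> of order \<open>t\<^sup>2\<close>.\<close>

lemma one_minus_Re_exp_le_square:
  assumes "Re z \<le> 0"
  shows "1 - Re (exp z) \<le> - Re z + (Im z)\<^sup>2 / 2"
proof -
  have "1 - cos (Im z) = 2 * (sin (Im z / 2))\<^sup>2" using cos_double_sin[of "Im z / 2"] by simp
  also have "\<dots> \<le> 2 * (Im z / 2)\<^sup>2"
    by (intro mult_left_mono abs_le_square_iff[THEN iffD1] abs_sin_x_le_abs_x) auto
  also have "\<dots> = (Im z)\<^sup>2 / 2" by (simp add: power2_eq_square)
  finally have "1 - cos (Im z) \<le> (Im z)\<^sup>2 / 2" .
  moreover have "exp (Re z) * (1 - cos (Im z)) \<le> 1 * (1 - cos (Im z))"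
    using assms by (intro mult_right_mono) auto
  moreover have "1 - exp (Re z) \<le> - Re z"
    using exp_ge_add_one_self[of "Re z"] by linarith
  ultimately show ?thesis unfolding Re_exp right_diff_distrib by linarith
qed

lemma powr_mono_small:
  fixes x :: real
  assumes "0 \<le> x" "x \<le> 1" "a \<le> b"
  shows "x powr b \<le> x powr a"
  using assms by (cases "x = 0") (auto intro: powr_mono')

lemma power_le_powr:
  fixes x :: real
  assumes "0 \<le> x" "x \<le> 1" "0 < n" "r \<le> real n"
  shows "x ^ n \<le> x powr r"
proof (cases "x = 0")
  case False
  then have "x ^ n = x powr real n" using assms by (simp add: powr_realpow)
  then show ?thesis using powr_mono_small[of x r "real n"] assms by simp
qed (use assms in \<open>simp add: power_0_left\<close>)

lemma norm_iexp_minus_one_le_powr: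
  assumes "0 < r" "r \<le> 1"
  shows "cmod (iexp y - 1) \<le> 2 * \<bar>y\<bar> powr r"
proof (cases "\<bar>y\<bar> \<le> 1")
  case True
  have "cmod (iexp y - 1) \<le> \<bar>y\<bar>" using iexp_approx1[of y 0] by simp
  also have "\<dots> \<le> \<bar>y\<bar> powr r" using power_le_powr[of "\<bar>y\<bar>" 1 r] True assms by simp
  finally show ?thesis by (smt (verit) powr_ge_zero)
next
  case False
  then have "1 \<le> \<bar>y\<bar> powr r" using assms by (intro ge_one_powr_ge_zero) auto
  then show ?thesis using iexp_approx2[of y 0] by simp
qed

lemma norm_iexp_minus_linear_le_powr:
  assumes "1 \<le> r" "r \<le> 2"
  shows "cmod (iexp y - 1 - \<i> * of_real y) \<le> 2 * \<bar>y\<bar> powr r"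
proof (cases "\<bar>y\<bar> \<le> 1")
  case True
  have "cmod (iexp y - 1 - \<i> * of_real y) \<le> y\<^sup>2 / 2"
    using iexp_approx1[of y 1] by (simp add: algebra_simps numeral_2_eq_2)
  also have "\<dots> \<le> 2 * \<bar>y\<bar> powr r"
    using power_le_powr[of "\<bar>y\<bar>" 2 r] True assms powr_ge_zero[of "\<bar>y\<bar>" r]
    unfolding power2_abs by linarith
  finally show ?thesis .
next
  case False
  have "cmod (iexp y - 1 - \<i> * of_real y) \<le> 2 * \<bar>y\<bar>"
    using iexp_approx2[of y 1] by (simp add: algebra_simps)
  also have "\<dots> \<le> 2 * \<bar>y\<bar> powr r"
    using powr_mono[of 1 r "\<bar>y\<bar>"] False assms by simp
  finally show ?thesis .
qed

lemma abs_sin_add_le: "\<bar>sin (x + y)\<bar> \<le> \<bar>sin x\<bar> + \<bar>sin (y::real)\<bar>"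
proof -
  have "\<bar>sin (x + y)\<bar> \<le> \<bar>sin x\<bar> * \<bar>cos y\<bar> + \<bar>cos x\<bar> * \<bar>sin y\<bar>"
    by (simp add: sin_add flip: abs_mult)
  also have "\<dots> \<le> \<bar>sin x\<bar> * 1 + 1 * \<bar>sin y\<bar>"
    by (intro add_mono mult_mono) auto
  finally show ?thesis by simp
qed

lemma power_add_le:
  fixes a b :: real
  assumes "0 \<le> a" "0 \<le> b"
  shows "(a + b) ^ n \<le> 2 ^ n * (a ^ n + b ^ n)"
proof -
  have "(a + b) ^ n \<le> (2 * max a b) ^ n" using assms by (intro power_mono) auto
  also have "\<dots> = 2 ^ n * (max a b) ^ n" by (simp add: power_mult_distrib)
  also have "\<dots> \<le> 2 ^ n * (a ^ n + b ^ n)"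
    using assms by (intro mult_left_mono) (auto simp: max_def)
  finally show ?thesis .
qed

text \<open>A crude form of Young's inequality. Derivatives of \<open>sin (u x / 2) ^ n\<close> have the form
  \<open>u ^ j sin (u x / 2) ^ (n - j)\<close> up to bounded factors, and this lemma brings them back to the \<open>n\<close>-th power plus
  an error \<open>u ^ n\<close>.\<close>

lemma young_power:
  fixes a b :: real
  assumes "0 \<le> a" "0 \<le> b"
  shows "a ^ m * b ^ n \<le> a ^ (m + n) + b ^ (m + n)"
proof (cases "a \<le> b")
  case True
  then have "a ^ m * b ^ n \<le> b ^ m * b ^ n" using assms by (intro mult_right_mono power_mono) auto
  then show ?thesis using assms by (simp add: power_add add_increasing)
next
  case False
  then have "a ^ m * b ^ n \<le> a ^ m * a ^ n" using assms by (intro mult_left_mono power_mono) auto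
  then show ?thesis using assms by (simp add: power_add add_increasing2)
qed

lemma sin_power_le_powr:
  assumes "0 < r" "r \<le> real n" "even n"
  shows "sin y ^ n \<le> \<bar>y\<bar> powr r"
proof -
  have s: "sin y ^ n = \<bar>sin y\<bar> ^ n" using assms by (simp add: power_even_abs)
  show ?thesis
  proof (cases "\<bar>y\<bar> \<le> 1")
    case True
    have "\<bar>sin y\<bar> ^ n \<le> \<bar>y\<bar> ^ n" by (intro power_mono) (auto simp: abs_sin_x_le_abs_x)
    also have "\<dots> \<le> \<bar>y\<bar> powr r" using True assms by (intro power_le_powr) auto
    finally show ?thesis using s by simp
  next
    case False
    then have "1 \<le> \<bar>y\<bar> powr r" using assms by (intro ge_one_powr_ge_zero) auto
    moreover have "\<bar>sin y\<bar> ^ n \<le> 1" by (intro power_le_one) auto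
    ultimately show ?thesis using s by simp
  qed
qed

section \<open>Absolute moments as integrals of sine powers\<close>

text \<open>The family of test functions. They are trigonometric polynomials in \<open>x\<close>, bounded by 1, comparable
  with \<open>(u x) ^ (2 * k)\<close> for small \<open>u x\<close>, and subadditive up to a constant factor.\<close>

definition sine_power :: "nat \<Rightarrow> real \<Rightarrow> real \<Rightarrow> real" where
  "sine_power k u x = sin (u * x / 2) ^ (2 * k)"

lemma sine_power_bounds: "0 \<le> sine_power k u x" "sine_power k u x \<le> 1"
proof -
  have "\<bar>sin (u * x / 2)\<bar> ^ (2 * k) \<le> 1" by (intro power_le_one) auto
  then show "0 \<le> sine_power k u x" "sine_power k u x \<le> 1" by (simp_all add: sine_power_def power_even_abs)
qed

lemma sine_power_measurable [measurable]: "sine_power k u \<in> borel_measurable borel"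
  unfolding sine_power_def by measurable

lemma sine_power_measurable_comp [measurable (raw)]:
  assumes [measurable]: "f \<in> borel_measurable M" "g \<in> borel_measurable M"
  shows "(\<lambda>x. sine_power k (f x) (g x)) \<in> borel_measurable M"
  unfolding sine_power_def by measurable

lemma powr_mult_real: "0 < (u::real) \<Longrightarrow> \<bar>u * x\<bar> powr r = u powr r * \<bar>x\<bar> powr r"
  by (simp add: abs_mult powr_mult)

lemma sine_power_le_powr:
  assumes "0 < u" "0 < r" "r \<le> 2 * real k"
  shows "sine_power k u y \<le> u powr r * \<bar>y\<bar> powr r"
proof -
  have "sine_power k u y \<le> \<bar>u * y / 2\<bar> powr r"
    unfolding sine_power_def using assms by (intro sin_power_le_powr) auto
  also have "\<dots> \<le> \<bar>u * y\<bar> powr r" using assms by (intro powr_mono2) auto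
  finally show ?thesis using assms by (simp add: powr_mult_real)
qed

lemma sine_power_1_tendsto: "((\<lambda>u. 4 / u\<^sup>2 * sine_power 1 u x) \<longlongrightarrow> x\<^sup>2) (at_right 0)"
proof (cases "x = 0")
  case False
  define y where "y = \<bar>x\<bar>"
  have y: "0 < y" using False by (simp add: y_def)
  have "((\<lambda>u. 4 / u\<^sup>2 * sin (u * y / 2) ^ 2) \<longlongrightarrow> 4 * (y / 2)\<^sup>2) (at_right 0)"
    using y by real_asymp
  also have "4 * (y / 2)\<^sup>2 = y\<^sup>2" by (simp add: power_divide)
  finally have "((\<lambda>u. 4 / u\<^sup>2 * sin (u * y / 2) ^ 2) \<longlongrightarrow> y\<^sup>2) (at_right 0)" .
  moreover have "sine_power 1 u x = sin (u * y / 2) ^ 2" for u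
    unfolding sine_power_def y_def by (cases "0 \<le> x") auto
  ultimately show ?thesis by (simp add: y_def)
qed (simp add: sine_power_def)

text \<open>The shape of the dominating functions: separate powers near \<open>0\<close> and near \<open>\<infinity>\<close>.\<close>

definition powr_profile :: "real \<Rightarrow> real \<Rightarrow> real \<Rightarrow> real" where
  "powr_profile a b u = (if u < 1 then u powr a else u powr b)"

lemma powr_profile_measurable [measurable]: "powr_profile a b \<in> borel_measurable borel"
  unfolding powr_profile_def by measurable

lemma nn_integral_powr_profile_finite:
  assumes "-1 < a" "b < -1"
  shows "(\<integral>\<^sup>+u\<in>{0<..}. ennreal (powr_profile a b u) \<partial>lborel) < \<infinity>"
proof -
  have 1: "(\<integral>\<^sup>+u. ennreal (u powr a) * indicator {0..1} u \<partial>lborel) = ennreal (1 / (a + 1))"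
    using has_integral_powr_from_0[of a 1] assms
    by (intro nn_integral_has_integral_lebesgue') auto
  have 2: "(\<integral>\<^sup>+u. ennreal (u powr b) * indicator {1..} u \<partial>lborel) = ennreal (-1 / (b + 1))"
    using has_integral_powr_to_inf[of b 1] assms
    by (intro nn_integral_has_integral_lebesgue') auto
  have "(\<integral>\<^sup>+u\<in>{0<..}. ennreal (powr_profile a b u) \<partial>lborel) \<le>
    (\<integral>\<^sup>+u. ennreal (u powr a) * indicator {0..1} u + ennreal (u powr b) * indicator {1..} u \<partial>lborel)"
    by (intro nn_integral_mono) (auto simp: powr_profile_def indicator_def)
  also have "\<dots> = ennreal (1 / (a + 1)) + ennreal (-1 / (b + 1))"
    by (subst nn_integral_add) (auto simp: 1 2)
  also have "\<dots> < \<infinity>" by simp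
  finally show ?thesis .
qed

definition sine_moment_const :: "real \<Rightarrow> nat \<Rightarrow> ennreal" where
  "sine_moment_const q k = (\<integral>\<^sup>+u\<in>{0<..}. ennreal (u powr (-1-q) * sin (u / 2) ^ (2 * k)) \<partial>lborel)"

lemma sine_moment_const_finite:
  assumes "0 < q" "q < 2 * real k"
  shows "sine_moment_const q k < \<infinity>"
proof -
  have "sine_moment_const q k \<le>
      (\<integral>\<^sup>+u\<in>{0<..}. ennreal (powr_profile (2 * real k - 1 - q) (-1-q) u) \<partial>lborel)"
    unfolding sine_moment_const_def
  proof (intro nn_integral_mono)
    fix u :: real
    have "u powr (-1-q) * sin (u / 2) ^ (2 * k) \<le> powr_profile (2 * real k - 1 - q) (-1-q) u"
      if "0 < u"
    proof (cases "u < 1")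
      case True
      have "sin (u / 2) ^ (2 * k) \<le> \<bar>u / 2\<bar> powr (2 * real k)"
        using assms by (intro sin_power_le_powr) auto
      also have "\<dots> \<le> u powr (2 * real k)" using that assms by (intro powr_mono2) auto
      finally have "u powr (-1-q) * sin (u / 2) ^ (2 * k) \<le> u powr (-1-q) * u powr (2 * real k)"
        by (intro mult_left_mono) auto
      also have "\<dots> = u powr (2 * real k - 1 - q)"
        by (simp flip: powr_add add: algebra_simps)
      finally show ?thesis using True by (simp add: powr_profile_def)
    next
      case False
      have "\<bar>sin (u / 2)\<bar> ^ (2 * k) \<le> 1" by (intro power_le_one) auto
      then have "u powr (-1-q) * sin (u / 2) ^ (2 * k) \<le> u powr (-1-q) * 1"
        by (intro mult_left_mono) (auto simp: power_even_abs)
      then show ?thesis using False by (simp add: powr_profile_def)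
    qed
    then show "ennreal (u powr (-1-q) * sin (u / 2) ^ (2 * k)) * indicator {0<..} u
       \<le> ennreal (powr_profile (2 * real k - 1 - q) (-1-q) u) * indicator {0<..} u"
      by (auto simp: indicator_def intro!: ennreal_leI)
  qed
  also have "\<dots> < \<infinity>"
    using assms by (intro nn_integral_powr_profile_finite) auto
  finally show ?thesis .
qed

lemma sine_moment_const_pos: "sine_moment_const q k > 0"
proof -
  \<comment> \<open>A lower bound for the integrand on \<open>{1..2}\<close>.\<close>
  define c where "c = 2 powr (-1-\<bar>q\<bar>) * sin (1/2::real) ^ (2 * k)"
  have s: "0 < sin (1/2::real)" by (intro sin_gt_zero) (use pi_gt3 in linarith)+
  then have c: "0 < c" by (simp add: c_def)
  have "ennreal c * emeasure lborel {1..2::real} = (\<integral>\<^sup>+u. ennreal c * indicator {1..2::real} u \<partial>lborel)"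
    by (rule nn_integral_cmult_indicator[symmetric]) simp
  also have "\<dots> \<le> sine_moment_const q k"
    unfolding sine_moment_const_def
  proof (intro nn_integral_mono)
    fix u :: real
    have "c \<le> u powr (-1-q) * sin (u / 2) ^ (2 * k)" if "1 \<le> u" "u \<le> 2"
      unfolding c_def
    proof (intro mult_mono power_mono)
      have "2 powr (-1-\<bar>q\<bar>) \<le> u powr (-1-\<bar>q\<bar>)" using that by (intro powr_mono2') auto
      also have "\<dots> \<le> u powr (-1-q)" using that by (intro powr_mono) auto
      finally show "2 powr (-1-\<bar>q\<bar>) \<le> u powr (-1-q)" .
      show "sin (1/2) \<le> sin (u/2)" using that pi_gt3 by (intro sin_monotone_2pi_le) auto
    qed (use s in auto)
    then show "ennreal c * indicator {1..2} u \<le>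
        ennreal (u powr (-1-q) * sin (u / 2) ^ (2 * k)) * indicator {0<..} u"
      by (auto simp: indicator_def intro!: ennreal_leI)
  qed
  finally show ?thesis using c by (auto simp: ennreal_zero_less_mult_iff intro: less_le_trans[rotated])
qed

text \<open>The substitution \<open>u \<mapsto> u / \<bar>x\<bar>\<close> pulls \<open>\<bar>x\<bar> powr q\<close> out of the integral; for \<open>x = 0\<close> both sides vanish.\<close>

lemma sine_moment_const_mult_powr:
  assumes "0 < k"
  shows "sine_moment_const q k * ennreal (\<bar>x\<bar> powr q) =
    (\<integral>\<^sup>+u\<in>{0<..}. ennreal (u powr (-1-q) * sine_power k u x) \<partial>lborel)"
proof (cases "x = 0")
  case True
  then show ?thesis using assms by (simp add: sine_power_def power_0_left)
next
  case False
  define y where "y = \<bar>x\<bar>"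
  have y: "0 < y" using False by (simp add: y_def)
  have "sine_power k u x = sin (u * y / 2) ^ (2 * k)" for u
    unfolding y_def sine_power_def by (cases "x \<ge> 0") (auto simp: power_mult)
  then have "(\<integral>\<^sup>+u\<in>{0<..}. ennreal (u powr (-1-q) * sine_power k u x) \<partial>lborel) =
      (\<integral>\<^sup>+u. ennreal (u powr (-1-q) * sin (u * y / 2) ^ (2 * k)) * indicator {0<..} u \<partial>lborel)"
    by simp
  also have "\<dots> = ennreal \<bar>1 / y\<bar> * (\<integral>\<^sup>+u. ennreal ((0 + 1 / y * u) powr (-1-q) *
      sin ((0 + 1 / y * u) * y / 2) ^ (2 * k)) * indicator {0<..} (0 + 1 / y * u) \<partial>lborel)"
    by (rule nn_integral_real_affine) (use y in auto)
  also have "\<dots> = (\<integral>\<^sup>+u. ennreal (y powr q) *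
      (ennreal (u powr (-1-q) * sin (u / 2) ^ (2 * k)) * indicator {0<..} u) \<partial>lborel)"
  proof (subst nn_integral_cmult[symmetric], simp, intro nn_integral_cong)
    fix u :: real
    have "1 / y * ((u / y) powr (-1-q)) = y powr q * u powr (-1-q)" if "0 < u"
      using y that by (simp add: powr_divide powr_diff powr_minus_divide field_simps)
    then have "\<bar>1 / y\<bar> * ((u / y) powr (-1-q) * sin (u / 2) ^ (2 * k)) =
        y powr q * (u powr (-1-q) * sin (u / 2) ^ (2 * k))" if "0 < u"
      using y that by (simp add: mult.assoc[symmetric] del: mult.assoc)
    then show "ennreal \<bar>1 / y\<bar> * (ennreal ((0 + 1 / y * u) powr (-1-q) *
      sin ((0 + 1 / y * u) * y / 2) ^ (2 * k)) * indicator {0<..} (0 + 1 / y * u)) =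
      ennreal (y powr q) * (ennreal (u powr (-1-q) * sin (u / 2) ^ (2 * k)) * indicator {0<..} u)"
      using y by (auto simp: indicator_def zero_less_divide_iff zero_le_mult_iff simp flip: ennreal_mult)
  qed
  also have "\<dots> = ennreal (y powr q) * sine_moment_const q k"
    unfolding sine_moment_const_def by (rule nn_integral_cmult) simp
  finally show ?thesis by (simp add: y_def mult.commute)
qed

text \<open>Tonelli's theorem integrates the previous identity over \<open>M\<close>. Sigma-finiteness of \<open>M\<close> makes it
  available for laws and for Levy measures alike.\<close>

lemma sine_moment_formula:
  assumes "sigma_finite_measure M" and [measurable]: "Y \<in> borel_measurable M" and "0 < k"
  shows "sine_moment_const q k * abs_moment M Y q =
    (\<integral>\<^sup>+u\<in>{0<..}. ennreal (u powr (-1-q)) *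
       (\<integral>\<^sup>+\<omega>. ennreal (sine_power k u (Y \<omega>)) \<partial>M) \<partial>lborel)"
proof -
  interpret M: sigma_finite_measure M by fact
  interpret pair_sigma_finite M lborel ..
  have "sine_moment_const q k * abs_moment M Y q =
      (\<integral>\<^sup>+\<omega>. sine_moment_const q k * ennreal (\<bar>Y \<omega>\<bar> powr q) \<partial>M)"
    unfolding abs_moment_def by (rule nn_integral_cmult[symmetric]) simp
  also have "\<dots> = (\<integral>\<^sup>+\<omega>. (\<integral>\<^sup>+u. ennreal (u powr (-1-q) * sine_power k u (Y \<omega>)) *
      indicator {0<..} u \<partial>lborel) \<partial>M)"
    using assms by (simp add: sine_moment_const_mult_powr)
  also have "\<dots> = (\<integral>\<^sup>+u. (\<integral>\<^sup>+\<omega>. ennreal (u powr (-1-q) * sine_power k u (Y \<omega>)) *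
      indicator {0<..} u \<partial>M) \<partial>lborel)"
    by (rule Fubini'[symmetric]) measurable
  also have "\<dots> = (\<integral>\<^sup>+u\<in>{0<..}. ennreal (u powr (-1-q)) *
       (\<integral>\<^sup>+\<omega>. ennreal (sine_power k u (Y \<omega>)) \<partial>M) \<partial>lborel)"
  proof (intro nn_integral_cong)
    fix u :: real
    have "(\<integral>\<^sup>+\<omega>. ennreal (u powr (-1-q) * sine_power k u (Y \<omega>)) * indicator {0<..} u \<partial>M) =
        (\<integral>\<^sup>+\<omega>. (ennreal (u powr (-1-q)) * indicator {0<..} u) * ennreal (sine_power k u (Y \<omega>)) \<partial>M)"
      by (intro nn_integral_cong) (simp add: ennreal_mult sine_power_bounds mult_ac)
    also have "\<dots> = (ennreal (u powr (-1-q)) * indicator {0<..} u) *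
        (\<integral>\<^sup>+\<omega>. ennreal (sine_power k u (Y \<omega>)) \<partial>M)"
      by (rule nn_integral_cmult) simp
    finally show "(\<integral>\<^sup>+\<omega>. ennreal (u powr (-1-q) * sine_power k u (Y \<omega>)) * indicator {0<..} u \<partial>M) =
        ennreal (u powr (-1-q)) * (\<integral>\<^sup>+\<omega>. ennreal (sine_power k u (Y \<omega>)) \<partial>M) * indicator {0<..} u"
      by (simp add: mult_ac)
  qed
  finally show ?thesis .
qed

text \<open>Dominated convergence in the moment formula. The order of the moment has to lie strictly between
  the exponents of the bounds: \<open>r > q\<close> makes \<open>u powr (r-1-q)\<close> integrable at \<open>0\<close>, and \<open>p < q\<close> makes
  \<open>u powr (p-1-q)\<close> integrable at \<open>\<infinity>\<close>. The weight \<open>c t\<close> will be \<open>1 / t\<close> for limits towards a Levy measure and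
  \<open>1\<close> for limits towards a law.\<close>

lemma tendsto_abs_moment:
  fixes c :: "real \<Rightarrow> ennreal" and Y :: "real \<Rightarrow> 'a \<Rightarrow> real" and Z :: "'b \<Rightarrow> real"
  assumes M: "sigma_finite_measure M" and Y: "\<And>t. 0 < t \<Longrightarrow> Y t \<in> borel_measurable M"
    and N: "sigma_finite_measure N" and Z: "Z \<in> borel_measurable N"
    and q: "0 < q" "q < 2 * real k" "q < r" "p < q"
    and small: "\<And>t u. 0 < t \<Longrightarrow> t < 1 \<Longrightarrow> 0 < u \<Longrightarrow> u < 1 \<Longrightarrow>
      c t * (\<integral>\<^sup>+\<omega>. ennreal (sine_power k u (Y t \<omega>)) \<partial>M) \<le> ennreal (C * u powr r)"
    and large: "\<And>t u. 0 < t \<Longrightarrow> t < 1 \<Longrightarrow> 1 \<le> u \<Longrightarrow>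
      c t * (\<integral>\<^sup>+\<omega>. ennreal (sine_power k u (Y t \<omega>)) \<partial>M) \<le> ennreal (C * u powr p)"
    and lim: "\<And>u. 0 < u \<Longrightarrow>
      ((\<lambda>t. c t * (\<integral>\<^sup>+\<omega>. ennreal (sine_power k u (Y t \<omega>)) \<partial>M)) \<longlongrightarrow>
       (\<integral>\<^sup>+z. ennreal (sine_power k u (Z z)) \<partial>N)) (at_right 0)"
  shows "((\<lambda>t. c t * abs_moment M (Y t) q) \<longlongrightarrow> abs_moment N Z q) (at_right 0)"
proof (rule tendsto_at_right_sequentially[of 0 1])
  fix S :: "nat \<Rightarrow> real"
  assume S: "\<And>n. 0 < S n" "\<And>n. S n < 1" "S \<longlonglongrightarrow> 0"
  note Y[OF S(1), measurable] Z[measurable]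
  interpret M: sigma_finite_measure M by fact
  interpret N: sigma_finite_measure N by fact
  define K where "K = sine_moment_const q k"
  have k: "0 < k" using q by (cases k) auto
  have K: "K \<noteq> 0" "K < \<infinity>"
    using sine_moment_const_pos[of q k] sine_moment_const_finite[of q k] q by (auto simp: K_def)
  have S0: "filterlim S (at_right 0) sequentially"
    using S by (auto simp: filterlim_at less_imp_neq[symmetric] intro!: always_eventually)
  define H where "H n u = c (S n) * (\<integral>\<^sup>+\<omega>. ennreal (sine_power k u (Y (S n) \<omega>)) \<partial>M)" for n u
  define G where "G u = (\<integral>\<^sup>+z. ennreal (sine_power k u (Z z)) \<partial>N)" for u
  have [measurable]: "H n \<in> borel_measurable borel" "G \<in> borel_measurable borel" for n
    unfolding H_def G_def by measurable
  have KH: "K * (c (S n) * abs_moment M (Y (S n)) q) =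
      (\<integral>\<^sup>+u\<in>{0<..}. ennreal (u powr (-1-q)) * H n u \<partial>lborel)" for n
  proof -
    have "K * (c (S n) * abs_moment M (Y (S n)) q) = c (S n) * (K * abs_moment M (Y (S n)) q)"
      by (simp add: mult_ac)
    also have "\<dots> = (\<integral>\<^sup>+u. c (S n) * (ennreal (u powr (-1-q)) *
       (\<integral>\<^sup>+\<omega>. ennreal (sine_power k u (Y (S n) \<omega>)) \<partial>M) * indicator {0<..} u) \<partial>lborel)"
      unfolding K_def by (subst sine_moment_formula[OF M _ k], simp, subst nn_integral_cmult, measurable)
    also have "\<dots> = (\<integral>\<^sup>+u\<in>{0<..}. ennreal (u powr (-1-q)) * H n u \<partial>lborel)"
      by (simp add: H_def mult_ac)
    finally show ?thesis .
  qed
  have "(\<lambda>n. \<integral>\<^sup>+u\<in>{0<..}. ennreal (u powr (-1-q)) * H n u \<partial>lborel) \<longlonglongrightarrow>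
      (\<integral>\<^sup>+u\<in>{0<..}. ennreal (u powr (-1-q)) * G u \<partial>lborel)"
  proof (rule nn_integral_dominated_convergence
      [where w = "\<lambda>u. ennreal C * (ennreal (powr_profile (r-1-q) (p-1-q) u) * indicator {0<..} u)"])
    fix n
    have "ennreal (u powr (-1-q)) * H n u \<le> ennreal C * ennreal (powr_profile (r-1-q) (p-1-q) u)"
      if "0 < u" for u
    proof (cases "u < 1")
      case True
      have "ennreal (u powr (-1-q)) * H n u \<le> ennreal (u powr (-1-q)) * ennreal (C * u powr r)"
        unfolding H_def using small[of "S n" u] S that True by (intro mult_left_mono) auto
      also have "\<dots> = ennreal C * ennreal (u powr (r-1-q))"
        by (simp add: ennreal_mult'' mult_ac flip: powr_add ennreal_mult'' mult.assoc)
           (simp add: algebra_simps ennreal_mult'' flip: powr_add)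
      finally show ?thesis using True by (simp add: powr_profile_def)
    next
      case False
      have "ennreal (u powr (-1-q)) * H n u \<le> ennreal (u powr (-1-q)) * ennreal (C * u powr p)"
        unfolding H_def using large[of "S n" u] S that False by (intro mult_left_mono) auto
      also have "\<dots> = ennreal C * ennreal (u powr (p-1-q))"
        by (simp add: ennreal_mult'' mult_ac flip: powr_add ennreal_mult'' mult.assoc)
           (simp add: algebra_simps ennreal_mult'' flip: powr_add)
      finally show ?thesis using False by (simp add: powr_profile_def)
    qed
    then show "AE u in lborel. ennreal (u powr (-1-q)) * H n u * indicator {0<..} u \<le>
        ennreal C * (ennreal (powr_profile (r-1-q) (p-1-q) u) * indicator {0<..} u)"
      by (auto simp: indicator_def)
  next
    show "(\<integral>\<^sup>+u. ennreal C * (ennreal (powr_profile (r-1-q) (p-1-q) u) * indicator {0<..} u) \<partial>lborel) < \<infinity>"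
      using nn_integral_powr_profile_finite[of "r-1-q" "p-1-q"] q
      by (subst nn_integral_cmult) (auto simp: ennreal_mult_less_top)
  next
    have "(\<lambda>n. ennreal (u powr (-1-q)) * H n u) \<longlonglongrightarrow> ennreal (u powr (-1-q)) * G u" if "0 < u" for u
      unfolding H_def G_def
      by (intro ennreal_tendsto_cmult filterlim_compose[OF lim S0] that) simp
    then show "AE u in lborel. (\<lambda>n. ennreal (u powr (-1-q)) * H n u * indicator {0<..} u) \<longlonglongrightarrow>
        ennreal (u powr (-1-q)) * G u * indicator {0<..} u"
      by (auto simp: indicator_def)
  qed measurable
  also have "(\<integral>\<^sup>+u\<in>{0<..}. ennreal (u powr (-1-q)) * G u \<partial>lborel) = K * abs_moment N Z q"
    unfolding K_def G_def by (rule sine_moment_formula[OF N Z k, symmetric])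
  finally have "(\<lambda>n. K * (c (S n) * abs_moment M (Y (S n)) q)) \<longlonglongrightarrow> K * abs_moment N Z q"
    by (simp only: KH)
  then have "(\<lambda>n. (1 / K) * (K * (c (S n) * abs_moment M (Y (S n)) q))) \<longlonglongrightarrow> (1 / K) * (K * abs_moment N Z q)"
    by (rule ennreal_tendsto_cmult[rotated]) (use K in \<open>auto simp: ennreal_divide_eq_top_iff less_top[symmetric]\<close>)
  moreover have "(1 / K) * (K * a) = a" for a
  proof -
    have "(1 / K) * (K * a) = (K / K) * a"
      by (simp add: divide_ennreal_def mult_ac)
    then show ?thesis using K by (simp add: ennreal_divide_self)
  qed
  ultimately show "(\<lambda>n. c (S n) * abs_moment M (Y (S n)) q) \<longlonglongrightarrow> abs_moment N Z q" by simp
qed simp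

section \<open>Levy measures and characteristic exponents\<close>

locale levy_triplet =
  fixes \<gamma> \<sigma> :: real and \<nu> :: "real measure"
  assumes levy: "levy_measure \<nu>"
begin

lemma sets_levy [measurable_cong]: "sets \<nu> = sets borel"
  using levy by (simp add: levy_measure_def)

lemma space_levy [simp]: "space \<nu> = UNIV"
  using sets_eq_imp_space_eq[OF sets_levy] by simp

lemma borel_measurable_levy: "borel_measurable \<nu> = borel_measurable borel"
  by (rule measurable_cong_sets) (simp_all add: sets_levy)

lemma integrable_min_square: "integrable \<nu> (\<lambda>x. min 1 (x\<^sup>2))"
  using levy by (intro integrableI_bounded) (auto simp: levy_measure_def)

lemma integrable_levyI:
  fixes f :: "real \<Rightarrow> 'b::{banach, second_countable_topology}"
  assumes [measurable]: "f \<in> borel_measurable borel" and "\<And>x. norm (f x) \<le> C * min 1 (x\<^sup>2)"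
  shows "integrable \<nu> f"
proof (rule Bochner_Integration.integrable_bound)
  show "integrable \<nu> (\<lambda>x. C * min 1 (x\<^sup>2))" using integrable_min_square by simp
  show "f \<in> borel_measurable \<nu>" by measurable
  have "norm (f x) \<le> norm (C * min 1 (x\<^sup>2))" for x
    using assms(2)[of x] by simp
  then show "AE x in \<nu>. norm (f x) \<le> norm (C * min 1 (x\<^sup>2))" by simp
qed

lemma integrable_large_jumps: "integrable \<nu> (indicator {x. 1 < \<bar>x\<bar>} :: real \<Rightarrow> real)"
proof (rule integrable_levyI[of _ 1])
  fix x :: real
  show "norm (indicator {x. 1 < \<bar>x\<bar>} x :: real) \<le> 1 * min 1 (x\<^sup>2)"
    using abs_square_less_1[of x] by (auto simp: indicator_def)
qed simp

text \<open>By Markov's inequality \<open>\<nu>\<close> is finite on the sets where \<open>n min 1 (x\<^sup>2) \<ge> 1\<close>. They exhaust the line except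
  for the origin, which is a null set.\<close>

lemma sigma_finite_levy: "sigma_finite_measure \<nu>"
proof
  \<comment> \<open>The set with index 0 covers the origin.\<close>
  define A where "A n = (if n = 0 then {0} else {x::real. 1 \<le> real n * min 1 (x\<^sup>2)})" for n
  have "\<exists>n. x \<in> A n" for x
  proof (cases "x = 0")
    case False
    then have "0 < min 1 (x\<^sup>2)" by simp
    then obtain n where "1 < real n * min 1 (x\<^sup>2)" using reals_Archimedean3 by blast
    then show ?thesis by (intro exI[of _ n]) (auto simp: A_def intro: gr0I)
  qed (auto simp: A_def intro: exI[of _ 0])
  moreover have "emeasure \<nu> (A n) \<noteq> \<infinity>" for n
  proof (cases "n = 0")
    case False
    have "emeasure \<nu> {x\<in>UNIV. 1 \<le> ennreal (real n) * ennreal (min 1 (x\<^sup>2))} \<le>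
        ennreal (real n) * (\<integral>\<^sup>+x. ennreal (min 1 (x\<^sup>2)) * indicator UNIV x \<partial>\<nu>)"
      by (rule nn_integral_Markov_inequality) (auto simp: sets_levy borel_measurable_levy)
    also have "\<dots> < \<infinity>"
      using levy by (simp add: levy_measure_def ennreal_mult_less_top)
    also have "{x\<in>UNIV. 1 \<le> ennreal (real n) * ennreal (min 1 (x\<^sup>2))} = A n"
      using False by (simp add: A_def flip: ennreal_mult)
    finally show ?thesis by simp
  qed (use levy in \<open>simp add: A_def levy_measure_def\<close>)
  moreover have "A n \<in> sets \<nu>" for n by (simp add: A_def sets_levy)
  ultimately show "\<exists>A. countable A \<and> A \<subseteq> sets \<nu> \<and> \<Union> A = space \<nu> \<and> (\<forall>a\<in>A. emeasure \<nu> a \<noteq> \<infinity>)"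
    by (intro exI[of _ "range A"]) auto
qed

text \<open>The two halves of the condition that \<open>\<nu>\<close> integrates \<open>\<bar>x\<bar> powr p\<close>. By monotonicity in \<open>p\<close> the first holds
  for every \<open>p\<close> above \<open>index_zero \<nu>\<close>, the second for every nonnegative \<open>p\<close> below \<open>index_infinity \<nu>\<close>.\<close>

definition small_moment :: "real \<Rightarrow> bool" where
  "small_moment p \<longleftrightarrow> integrable \<nu> (\<lambda>x. \<bar>x\<bar> powr p * indicator {x. \<bar>x\<bar> \<le> 1} x)"

definition large_moment :: "real \<Rightarrow> bool" where
  "large_moment p \<longleftrightarrow> integrable \<nu> (\<lambda>x. \<bar>x\<bar> powr p * indicator {x. 1 < \<bar>x\<bar>} x)"

lemma small_moment_2: "small_moment 2"
  unfolding small_moment_def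
  by (rule integrable_levyI[of _ 1]) (auto simp: indicator_def abs_square_le_1)

lemma small_moment_mono: "small_moment p \<Longrightarrow> p \<le> p' \<Longrightarrow> small_moment p'"
  unfolding small_moment_def
  by (erule Bochner_Integration.integrable_bound) (auto simp: indicator_def powr_mono_small)

lemma large_moment_antimono: "large_moment p \<Longrightarrow> p' \<le> p \<Longrightarrow> large_moment p'"
  unfolding large_moment_def
  by (erule Bochner_Integration.integrable_bound) (auto simp: indicator_def intro: powr_mono)

lemma integrable_powr:
  assumes "small_moment p" "large_moment p"
  shows "integrable \<nu> (\<lambda>x. \<bar>x\<bar> powr p)"
proof -
  have "integrable \<nu> (\<lambda>x. \<bar>x\<bar> powr p * indicator {x. \<bar>x\<bar> \<le> 1} x + \<bar>x\<bar> powr p * indicator {x. 1 < \<bar>x\<bar>} x)"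
    using assms unfolding small_moment_def large_moment_def by (rule Bochner_Integration.integrable_add)
  also have "(\<lambda>x. \<bar>x\<bar> powr p * indicator {x. \<bar>x\<bar> \<le> 1} x + \<bar>x\<bar> powr p * indicator {x. 1 < \<bar>x\<bar>} x) =
     (\<lambda>x::real. \<bar>x\<bar> powr p)" by (auto simp: indicator_def)
  finally show ?thesis .
qed

lemma index_interval_pos: "q \<in> index_interval \<nu> \<Longrightarrow> 0 < q"
proof -
  assume "q \<in> index_interval \<nu>"
  moreover have "0 \<le> index_zero \<nu>"
    unfolding index_zero_def by (intro Inf_greatest) auto
  ultimately show "0 < q"
    unfolding index_interval_def using le_less_trans[of 0 "index_zero \<nu>" "ereal q"] by simp
qed

text \<open>There is room between the index and \<open>q\<close>, and the parameter \<open>a\<close> confines the exponent to a prescribed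
  window below \<open>q\<close>.\<close>

lemma index_zero_small_moment:
  assumes "index_zero \<nu> < ereal q" "a < q"
  obtains p where "a < p" "p < q" "small_moment p"
proof -
  obtain \<beta> where b: "\<beta> < q" "(\<integral>\<^sup>+x\<in>{x. \<bar>x\<bar> \<le> 1}. ennreal (\<bar>x\<bar> powr \<beta>) \<partial>\<nu>) < \<infinity>"
    using assms(1) unfolding index_zero_def by (auto simp: Inf_less_iff)
  have "small_moment \<beta>" unfolding small_moment_def
    by (rule integrableI_bounded) (use b(2) in \<open>auto simp: borel_measurable_levy ennreal_mult'' ennreal_indicator\<close>)
  then have "small_moment (max \<beta> ((a + q) / 2))" by (rule small_moment_mono) simp
  then show ?thesis by (rule that[rotated 2]) (use b assms in \<open>auto simp: less_max_iff_disj min_less_iff_disj\<close>)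
qed

lemma index_infinity_large_moment:
  assumes "ereal q < index_infinity \<nu>" "q < a"
  obtains p where "q < p" "p < a" "large_moment p"
proof -
  obtain \<beta> where b: "q < \<beta>" "(\<integral>\<^sup>+x\<in>{x. \<bar>x\<bar> > 1}. ennreal (\<bar>x\<bar> powr \<beta>) \<partial>\<nu>) < \<infinity>"
    using assms(1) unfolding index_infinity_def by (auto simp: less_Sup_iff)
  have "large_moment \<beta>" unfolding large_moment_def
    by (rule integrableI_bounded) (use b(2) in \<open>auto simp: borel_measurable_levy ennreal_mult'' ennreal_indicator\<close>)
  then have "large_moment (min \<beta> ((a + q) / 2))" by (rule large_moment_antimono) simp
  then show ?thesis by (rule that[rotated 2]) (use b assms in \<open>auto simp: less_max_iff_disj min_less_iff_disj\<close>)
qed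

definition levy_kernel :: "real \<Rightarrow> real \<Rightarrow> complex" where
  "levy_kernel u x = iexp (u * x) - 1 - \<i> * of_real (u * x * indicator {x. \<bar>x\<bar> \<le> 1} x)"

lemma levy_kernel_measurable [measurable]: "levy_kernel u \<in> borel_measurable borel"
  unfolding levy_kernel_def by measurable

abbreviation \<Psi> :: "real \<Rightarrow> complex" where "\<Psi> \<equiv> levy_exponent \<gamma> \<sigma> \<nu>"

lemma exponent_eq:
  "\<Psi> u = \<i> * of_real (\<gamma> * u) - of_real (\<sigma>\<^sup>2 / 2 * u\<^sup>2) + (CLINT x|\<nu>. levy_kernel u x)"
  by (simp add: levy_exponent_def levy_kernel_def)

lemma norm_iexp_minus_one_le_2: "cmod (iexp y - 1) \<le> 2"
  using iexp_approx2[of y 0] by simp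

lemma norm_levy_kernel_le: "cmod (levy_kernel u x) \<le> (2 + 2 * u\<^sup>2) * min 1 (x\<^sup>2)"
proof (cases "\<bar>x\<bar> \<le> 1")
  case True
  have "cmod (levy_kernel u x) \<le> 2 * (u * x)\<^sup>2"
    using norm_iexp_minus_linear_le_powr[of 2 "u * x"] True by (simp add: levy_kernel_def)
  also have "\<dots> \<le> (2 + 2 * u\<^sup>2) * x\<^sup>2"
    by (simp add: power_mult_distrib algebra_simps)
  also have "x\<^sup>2 = min 1 (x\<^sup>2)" using True by (simp add: abs_square_le_1)
  finally show ?thesis .
next
  case False
  then have "1 \<le> x\<^sup>2" using abs_square_less_1[of x] by linarith
  moreover have "cmod (levy_kernel u x) \<le> 2 + 2 * u\<^sup>2"
    using norm_iexp_minus_one_le_2[of "u * x"] False zero_le_power2[of u]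
    unfolding levy_kernel_def by (simp add: order_trans)
  ultimately show ?thesis by simp
qed

lemma integrable_levy_kernel: "integrable \<nu> (levy_kernel u)"
  by (rule integrable_levyI[OF _ norm_levy_kernel_le]) simp

text \<open>If \<open>f\<close> fails to be integrable, its integral is 0 by convention and the bound holds because
  \<open>c * g x\<close> is nonnegative.\<close>

lemma norm_integral_le:
  fixes f :: "real \<Rightarrow> complex"
  assumes "integrable \<nu> g" "\<And>x. cmod (f x) \<le> c * g x"
  shows "cmod (CLINT x|\<nu>. f x) \<le> c * (LINT x|\<nu>. g x)"
proof -
  have "cmod (CLINT x|\<nu>. f x) \<le> (LINT x|\<nu>. c * g x)"
  proof (cases "integrable \<nu> f")
    case True
    show ?thesis
      by (rule Bochner_Integration.integral_norm_bound_integral[OF True]) (use assms in auto)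
  next
    case False
    have "0 \<le> c * g x" for x using order_trans[OF norm_ge_zero assms(2)[of x]] .
    then have "0 \<le> (LINT x|\<nu>. c * g x)" by (intro integral_nonneg_AE) auto
    then show ?thesis using False by (simp add: not_integrable_integral_eq)
  qed
  then show ?thesis by simp
qed

text \<open>The compensated jump integrand is at most \<open>2 \<bar>u x\<bar> powr p\<close> on the small jumps, and the large jumps
  contribute a bounded term. The drift is linear in \<open>u\<close>, which forces \<open>p \<ge> 1\<close>, and a Gaussian part forces
  \<open>p = 2\<close>.\<close>

lemma exponent_growth:
  assumes "1 \<le> p" "p \<le> 2" "small_moment p" "\<sigma> = 0 \<or> p = 2"
  obtains C where "0 \<le> C" "\<And>u. 1 \<le> u \<Longrightarrow> cmod (\<Psi> u) \<le> C * u powr p"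
proof
  define g where "g x = 2 * (\<bar>x\<bar> powr p * indicator {x. \<bar>x\<bar> \<le> 1} x) + 2 * indicator {x. 1 < \<bar>x\<bar>} x" for x :: real
  have g: "integrable \<nu> g"
    using assms(3) integrable_large_jumps unfolding g_def small_moment_def by simp
  have g0: "0 \<le> g x" for x by (simp add: g_def)
  show "0 \<le> \<bar>\<gamma>\<bar> + \<sigma>\<^sup>2 / 2 + (LINT x|\<nu>. g x)" using g0 by simp
  fix u :: real assume u: "1 \<le> u"
  have up: "1 \<le> u powr p" "u \<le> u powr p"
    using u assms powr_mono[of 1 p u] by (auto intro: ge_one_powr_ge_zero)
  have "cmod (levy_kernel u x) \<le> u powr p * g x" for x
  proof (cases "\<bar>x\<bar> \<le> 1")
    case True
    then show ?thesis
      using norm_iexp_minus_linear_le_powr[of p "u * x"] assms u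
      by (simp add: levy_kernel_def g_def powr_mult_real mult_ac)
  next
    case False
    have "cmod (levy_kernel u x) \<le> 1 * 2"
      using False norm_iexp_minus_one_le_2[of "u * x"] by (simp add: levy_kernel_def)
    also have "\<dots> \<le> u powr p * 2" using up by (intro mult_right_mono) auto
    finally show ?thesis using False by (simp add: g_def)
  qed
  from norm_integral_le[OF g this]
  have 1: "cmod (CLINT x|\<nu>. levy_kernel u x) \<le> u powr p * (LINT x|\<nu>. g x)" .
  have 2: "cmod (\<i> * of_real (\<gamma> * u)) \<le> \<bar>\<gamma>\<bar> * u powr p"
    using up u by (simp add: norm_mult abs_mult mult_left_mono)
  have 3: "cmod (of_real (\<sigma>\<^sup>2 / 2 * u\<^sup>2)) \<le> \<sigma>\<^sup>2 / 2 * u powr p"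
    using assms(4) u by (auto simp: norm_mult norm_power norm_divide)
  have "cmod (\<Psi> u) \<le> cmod (\<i> * of_real (\<gamma> * u)) + cmod (of_real (\<sigma>\<^sup>2 / 2 * u\<^sup>2)) +
      cmod (CLINT x|\<nu>. levy_kernel u x)"
    unfolding exponent_eq by (intro norm_triangle_le add_mono norm_triangle_ineq4 order_refl)
  then show "cmod (\<Psi> u) \<le> (\<bar>\<gamma>\<bar> + \<sigma>\<^sup>2 / 2 + (LINT x|\<nu>. g x)) * u powr p"
    using 1 2 3 by (simp add: algebra_simps)
qed

lemma exponent_drift_form:
  assumes "small_moment 1"
  shows "\<Psi> u = \<i> * of_real (levy_drift \<gamma> \<nu> * u) - of_real (\<sigma>\<^sup>2 / 2 * u\<^sup>2) + (CLINT x|\<nu>. iexp (u * x) - 1)"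
proof -
  define f where "f x = x * indicator {x. \<bar>x\<bar> \<le> 1} x" for x :: real
  have f: "integrable \<nu> f"
    by (rule Bochner_Integration.integrable_bound[OF assms[unfolded small_moment_def]])
       (auto simp: f_def[abs_def] indicator_def borel_measurable_levy)
  then have fc: "integrable \<nu> (\<lambda>x. \<i> * of_real (u * f x))"
    by (intro integrable_mult_right integrable_of_real) simp
  have "(CLINT x|\<nu>. iexp (u * x) - 1) = (CLINT x|\<nu>. levy_kernel u x + \<i> * of_real (u * f x))"
    by (simp add: levy_kernel_def f_def mult_ac)
  also have "\<dots> = (CLINT x|\<nu>. levy_kernel u x) + (CLINT x|\<nu>. \<i> * of_real (u * f x))"
    by (rule Bochner_Integration.integral_add[OF integrable_levy_kernel fc])
  also have "(CLINT x|\<nu>. \<i> * of_real (u * f x)) = \<i> * of_real (u * (LINT x|\<nu>. f x))"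
    by (simp del: of_real_mult)
  finally show ?thesis
    by (simp add: exponent_eq levy_drift_def set_lebesgue_integral_def f_def algebra_simps)
qed

text \<open>Once the drift is removed, exponents below 1 become possible.\<close>

lemma exponent_minus_drift_growth:
  assumes "0 < p" "p \<le> 1" "small_moment p" "\<sigma> = 0"
  obtains C where "0 \<le> C" "\<And>u. 1 \<le> u \<Longrightarrow> cmod (\<Psi> u - \<i> * of_real (levy_drift \<gamma> \<nu> * u)) \<le> C * u powr p"
proof
  define g where "g x = 2 * (\<bar>x\<bar> powr p * indicator {x. \<bar>x\<bar> \<le> 1} x) + 2 * indicator {x. 1 < \<bar>x\<bar>} x" for x :: real
  have g: "integrable \<nu> g"
    using assms(3) integrable_large_jumps unfolding g_def small_moment_def by simp
  have s1: "small_moment 1" using small_moment_mono assms by blast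
  show "0 \<le> (LINT x|\<nu>. g x)" by (simp add: g_def)
  fix u :: real assume u: "1 \<le> u"
  have up: "1 \<le> u powr p"
    using u assms by (auto intro: ge_one_powr_ge_zero)
  have "cmod (iexp (u * x) - 1) \<le> u powr p * g x" for x
  proof (cases "\<bar>x\<bar> \<le> 1")
    case True
    then show ?thesis
      using norm_iexp_minus_one_le_powr[of p "u * x"] assms u
      by (simp add: g_def powr_mult_real mult_ac)
  next
    case False
    have "cmod (iexp (u * x) - 1) \<le> 1 * 2"
      using norm_iexp_minus_one_le_2[of "u * x"] by simp
    also have "\<dots> \<le> u powr p * 2" using up by (intro mult_right_mono) auto
    finally show ?thesis using False by (simp add: g_def)
  qed
  from norm_integral_le[OF g this]
  show "cmod (\<Psi> u - \<i> * of_real (levy_drift \<gamma> \<nu> * u)) \<le> (LINT x|\<nu>. g x) * u powr p"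
    using exponent_drift_form[OF s1, of u] assms(4) by (simp add: mult.commute)
qed

text \<open>In contrast to the previous bound this one holds down to \<open>u = 0\<close>, at the price of a condition on the
  large jumps. It gives \<open>t \<Psi> (v / t) \<rightarrow> \<i> \<delta> v\<close> with \<open>\<delta>\<close> the drift, with error \<open>O(v powr p t powr (1 - p))\<close>.\<close>

lemma exponent_minus_drift_powr:
  assumes "0 < p" "p \<le> 1" "small_moment p" "large_moment p" "\<sigma> = 0"
  obtains C where "0 \<le> C" "\<And>u. 0 < u \<Longrightarrow> cmod (\<Psi> u - \<i> * of_real (levy_drift \<gamma> \<nu> * u)) \<le> C * u powr p"
proof
  have s1: "small_moment 1" using small_moment_mono assms by blast
  show "0 \<le> 2 * (LINT x|\<nu>. \<bar>x\<bar> powr p)" by simp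
  fix u :: real assume u: "0 < u"
  have "cmod (iexp (u * x) - 1) \<le> (2 * u powr p) * \<bar>x\<bar> powr p" for x
    using norm_iexp_minus_one_le_powr[of p "u * x"] assms u by (simp add: powr_mult_real mult_ac)
  from norm_integral_le[OF integrable_powr[OF assms(3,4)] this]
  show "cmod (\<Psi> u - \<i> * of_real (levy_drift \<gamma> \<nu> * u)) \<le> 2 * (LINT x|\<nu>. \<bar>x\<bar> powr p) * u powr p"
    using exponent_drift_form[OF s1, of u] assms(5) by (simp add: mult_ac)
qed

text \<open>The jump part of the exponent is of smaller order than \<open>u\<^sup>2\<close>: \<open>\<bar>levy_kernel u x\<bar> / u\<^sup>2\<close> tends to 0 for each
  \<open>x\<close> and is dominated by \<open>4 min 1 (x\<^sup>2)\<close> for \<open>u \<ge> 1\<close>.\<close>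

lemma exponent_over_square_tendsto:
  "((\<lambda>u. \<Psi> u / of_real (u\<^sup>2)) \<longlongrightarrow> - of_real (\<sigma>\<^sup>2 / 2)) at_top"
proof -
  have "((\<lambda>u. CLINT x|\<nu>. levy_kernel u x / of_real (u\<^sup>2)) \<longlongrightarrow> (CLINT x|\<nu>. 0)) at_top"
  proof (rule integral_dominated_convergence_at_top[where w = "\<lambda>x. 4 * min 1 (x\<^sup>2)"])
    show "\<forall>\<^sub>F u in at_top. AE x in \<nu>. cmod (levy_kernel u x / of_real (u\<^sup>2)) \<le> 4 * min 1 (x\<^sup>2)"
      using eventually_ge_at_top[of 1]
    proof eventually_elim
      case (elim u)
      then have u: "1 \<le> u\<^sup>2" by (simp add: one_le_power)
      have "cmod (levy_kernel u x / of_real (u\<^sup>2)) \<le> 4 * min 1 (x\<^sup>2)" for x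
      proof -
        have "cmod (levy_kernel u x) \<le> (2 + 2 * u\<^sup>2) * min 1 (x\<^sup>2)" by (rule norm_levy_kernel_le)
        also have "\<dots> \<le> (4 * u\<^sup>2) * min 1 (x\<^sup>2)" using u by (intro mult_right_mono) auto
        finally show ?thesis using u elim by (simp add: norm_divide norm_power divide_le_eq mult_ac)
      qed
      then show ?case by simp
    qed
    have "((\<lambda>u. levy_kernel u x / of_real (u\<^sup>2)) \<longlongrightarrow> 0) at_top" for x
    proof (rule Lim_null_comparison)
      show "\<forall>\<^sub>F u in at_top. cmod (levy_kernel u x / of_real (u\<^sup>2)) \<le> (2 + \<bar>x\<bar> * u) / u\<^sup>2"
        using eventually_ge_at_top[of 1]
      proof eventually_elim
        case (elim u)
        have "cmod (levy_kernel u x) \<le> cmod (iexp (u * x) - 1) + cmod (\<i> * of_real (u * x * indicator {x. \<bar>x\<bar> \<le> 1} x))"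
          unfolding levy_kernel_def by (rule norm_triangle_ineq4)
        also have "\<dots> \<le> 2 + \<bar>x\<bar> * u"
          using elim norm_iexp_minus_one_le_2[of "u * x"]
          by (intro add_mono) (auto simp: norm_mult indicator_def)
        finally show ?case using elim by (simp add: norm_divide norm_power divide_right_mono)
      qed
      show "((\<lambda>u. (2 + \<bar>x\<bar> * u) / u\<^sup>2) \<longlongrightarrow> 0) at_top" by real_asymp
    qed
    then show "AE x in \<nu>. ((\<lambda>u. levy_kernel u x / of_real (u\<^sup>2)) \<longlongrightarrow> 0) at_top" by simp
  qed (use integrable_min_square in \<open>auto simp: borel_measurable_levy\<close>)
  then have "((\<lambda>u. \<i> * of_real (\<gamma> * (1 / u)) - of_real (\<sigma>\<^sup>2 / 2) + (CLINT x|\<nu>. levy_kernel u x / of_real (u\<^sup>2)))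
       \<longlongrightarrow> \<i> * of_real (\<gamma> * 0) - of_real (\<sigma>\<^sup>2 / 2) + (CLINT x|\<nu>. 0)) at_top"
    by (intro tendsto_intros) real_asymp
  moreover have "\<forall>\<^sub>F u in at_top. \<i> * of_real (\<gamma> * (1 / u)) - of_real (\<sigma>\<^sup>2 / 2) + (CLINT x|\<nu>. levy_kernel u x / of_real (u\<^sup>2))
      = \<Psi> u / of_real (u\<^sup>2)"
    using eventually_gt_at_top[of 0]
  proof eventually_elim
    case (elim u)
    then show ?case by (simp add: exponent_eq add_divide_distrib diff_divide_distrib power2_eq_square)
  qed
  ultimately show ?thesis by (auto intro: Lim_transform_eventually)
qed

lemma Re_exponent: "Re (\<Psi> u) = - (\<sigma>\<^sup>2 / 2 * u\<^sup>2) - (LINT x|\<nu>. 1 - cos (u * x))"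
proof -
  have "Re (CLINT x|\<nu>. levy_kernel u x) = (LINT x|\<nu>. Re (levy_kernel u x))"
    using integrable_levy_kernel by simp
  also have "\<dots> = - (LINT x|\<nu>. 1 - cos (u * x))"
    by (subst Bochner_Integration.integral_minus[symmetric]) (simp add: levy_kernel_def Re_exp)
  finally show ?thesis by (simp add: exponent_eq)
qed

lemma Im_exponent: "Im (\<Psi> u) = \<gamma> * u + (LINT x|\<nu>. sin (u * x) - u * x * indicator {x. \<bar>x\<bar> \<le> 1} x)"
proof -
  have "Im (CLINT x|\<nu>. levy_kernel u x) = (LINT x|\<nu>. Im (levy_kernel u x))"
    using integrable_levy_kernel by simp
  also have "\<dots> = (LINT x|\<nu>. sin (u * x) - u * x * indicator {x. \<bar>x\<bar> \<le> 1} x)"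
    by (simp add: levy_kernel_def Im_exp)
  finally show ?thesis by (simp add: exponent_eq)
qed

lemma Re_exponent_le_0: "Re (\<Psi> u) \<le> 0"
proof -
  have "0 \<le> (LINT x|\<nu>. 1 - cos (u * x))" by (intro integral_nonneg_AE) auto
  moreover have "0 \<le> \<sigma>\<^sup>2 / 2 * u\<^sup>2" by simp
  ultimately show ?thesis unfolding Re_exponent by linarith
qed

end

section \<open>The generator on trigonometric polynomials\<close>

lemma has_vector_derivative_iexp:
  "((\<lambda>x. iexp (\<theta> * x)) has_vector_derivative \<i> * of_real \<theta> * iexp (\<theta> * x)) (at x)"
proof -
  have "((\<lambda>z. exp (\<i> * of_real \<theta> * z)) has_field_derivative \<i> * of_real \<theta> * exp (\<i> * of_real \<theta> * of_real x)) (at (of_real x))"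
    by (auto intro!: derivative_eq_intros)
  from has_vector_derivative_real_field[OF this, of UNIV] show ?thesis
    by (simp add: mult_ac)
qed

text \<open>A real trigonometric polynomial is represented by its complex Fourier coefficients and frequencies.
  Its derivatives are given separately as real functions, because explicit formulas for them are needed
  in estimates; by uniqueness of derivatives their coefficients are the expected ones.\<close>

lemma trig_poly_derivative:
  fixes f :: "real \<Rightarrow> real"
  assumes f: "\<And>x. of_real (f x) = (\<Sum>j\<in>J. a j * iexp (\<theta> j * x))"
    and f': "\<And>x. (f has_real_derivative f' x) (at x)"
  shows "of_real (f' x) = (\<Sum>j\<in>J. (\<i> * of_real (\<theta> j) * a j) * iexp (\<theta> j * x))"
proof (rule vector_derivative_unique_at)
  show "((\<lambda>x. complex_of_real (f x)) has_vector_derivative of_real (f' x)) (at x)"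
    using f'[of x] by (intro bounded_linear.has_vector_derivative[OF bounded_linear_of_real])
      (simp add: has_real_derivative_iff_has_vector_derivative)
  show "((\<lambda>x. complex_of_real (f x)) has_vector_derivative
      (\<Sum>j\<in>J. (\<i> * of_real (\<theta> j) * a j) * iexp (\<theta> j * x))) (at x)"
    unfolding f
  proof (rule has_vector_derivative_sum)
    fix j
    have "((\<lambda>x. a j * iexp (\<theta> j * x)) has_vector_derivative
        a j * (\<i> * of_real (\<theta> j) * iexp (\<theta> j * x))) (at x)"
      by (rule bounded_linear.has_vector_derivative[OF bounded_linear_mult_right has_vector_derivative_iexp])
    then show "((\<lambda>x. a j * iexp (\<theta> j * x)) has_vector_derivative
        (\<i> * of_real (\<theta> j) * a j) * iexp (\<theta> j * x)) (at x)"
      by (simp add: mult_ac)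
  qed
qed

text \<open>The binomial theorem applied to \<open>sin y = (exp (\<i> y) - exp (- \<i> y)) / (2 \<i>)\<close>.\<close>

lemma sin_power_trig_poly:
  "complex_of_real (sin (u * x / 2) ^ n) =
    (\<Sum>j\<le>n. ((1 / (2 * \<i>)) ^ n * of_nat (n choose j) * (-1) ^ (n - j)) * iexp ((u / 2 * (2 * real j - real n)) * x))"
proof -
  define y where "y = u * x / 2"
  have "complex_of_real (sin y) = (1 / (2 * \<i>)) * (iexp y + (- iexp (- y)))"
    using sin_exp_eq[of "of_real y :: complex"] by (simp add: sin_of_real)
  then have "complex_of_real (sin y ^ n) = (1 / (2 * \<i>)) ^ n * (iexp y + (- iexp (- y))) ^ n"
    by (simp only: power_mult_distrib of_real_power)
  also have "(iexp y + (- iexp (- y))) ^ n =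
      (\<Sum>j\<le>n. of_nat (n choose j) * iexp y ^ j * (- iexp (- y)) ^ (n - j))"
    by (rule binomial_ring)
  also have "(1 / (2 * \<i>)) ^ n * \<dots> = (\<Sum>j\<le>n. ((1 / (2 * \<i>)) ^ n * of_nat (n choose j) * (-1) ^ (n - j)) *
      iexp ((u / 2 * (2 * real j - real n)) * x))"
    unfolding sum_distrib_left
  proof (rule sum.cong)
    fix j assume "j \<in> {..n}"
    then have j: "j \<le> n" by simp
    have "iexp y ^ j * (- iexp (- y)) ^ (n - j) = (-1) ^ (n - j) * (iexp y ^ j * iexp (- y) ^ (n - j))"
      by (subst power_minus) (simp add: mult_ac)
    also have "iexp y ^ j * iexp (- y) ^ (n - j) = iexp ((u / 2 * (2 * real j - real n)) * x)"
    proof -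
      have "of_nat j * (\<i> * of_real y) + of_nat (n - j) * (\<i> * of_real (- y)) =
          \<i> * complex_of_real ((u / 2 * (2 * real j - real n)) * x)"
        using j by (simp add: y_def of_nat_diff field_simps)
      moreover have "iexp y ^ j * iexp (- y) ^ (n - j) =
          exp (of_nat j * (\<i> * of_real y) + of_nat (n - j) * (\<i> * of_real (- y)))"
        by (simp only: exp_add exp_of_nat_mult)
      ultimately show ?thesis by (simp only:)
    qed
    finally show "(1 / (2 * \<i>)) ^ n * (of_nat (n choose j) * iexp y ^ j * (- iexp (- y)) ^ (n - j)) =
      ((1 / (2 * \<i>)) ^ n * of_nat (n choose j) * (-1) ^ (n - j)) * iexp ((u / 2 * (2 * real j - real n)) * x)"
      by (simp only: mult.assoc)
  qed simp
  finally show ?thesis by (simp add: y_def)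
qed

lemma gronwall_affine:
  fixes h :: "real \<Rightarrow> real"
  assumes h: "\<And>t. 0 \<le> t \<Longrightarrow> (h has_real_derivative h' t) (at t within {0..})"
    and h': "\<And>t. 0 \<le> t \<Longrightarrow> h' t \<le> A * h t + B"
    and h0: "h 0 = 0" and AB: "0 \<le> A" "0 \<le> B" and t: "0 \<le> t"
  shows "h t \<le> B * t * exp (A * t)"
proof -
  \<comment> \<open>The function \<open>g\<close> vanishes at 0 and is nonincreasing.\<close>
  define g where "g \<tau> = h \<tau> * exp (- (A * \<tau>)) - B * \<tau>" for \<tau>
  have g: "(g has_real_derivative (h' \<tau> - A * h \<tau>) * exp (- (A * \<tau>)) - B) (at \<tau> within {0..})"
    if "0 \<le> \<tau>" for \<tau>
    unfolding g_def using h[OF that]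
    by (auto intro!: derivative_eq_intros simp: algebra_simps)
  have "g t \<le> g 0"
  proof (rule DERIV_nonpos_imp_decreasing_open[OF t])
    fix \<tau> assume \<tau>: "0 < \<tau>" "\<tau> < t"
    have "(h' \<tau> - A * h \<tau>) * exp (- (A * \<tau>)) \<le> B * exp (- (A * \<tau>))"
      using h'[of \<tau>] \<tau> by (intro mult_right_mono) auto
    also have "\<dots> \<le> B * 1" using AB \<tau> by (intro mult_left_mono) auto
    finally show "\<exists>y. DERIV g \<tau> :> y \<and> y \<le> 0"
      using g[of \<tau>] \<tau> by (intro exI[of _ "(h' \<tau> - A * h \<tau>) * exp (- (A * \<tau>)) - B"])
        (auto simp: at_within_open[of \<tau> "{0<..}", symmetric] intro: DERIV_subset)
  next
    show "continuous_on {0..t} g"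
      by (rule continuous_on_subset[OF DERIV_continuous_on[of "{0..}"]]) (use g in auto)
  qed
  then have "h t * exp (- (A * t)) \<le> B * t" by (simp add: g_def h0)
  then have "h t * exp (- (A * t)) * exp (A * t) \<le> B * t * exp (A * t)"
    by (rule mult_right_mono) simp
  then show ?thesis by (simp add: mult.assoc flip: exp_add)
qed

text \<open>Two applications of the mean value inequality, first to \<open>f1\<close> and then to \<open>f z - z * f1 x\<close>.\<close>

lemma second_order_bound:
  fixes f :: "real \<Rightarrow> real"
  assumes f: "\<And>x. (f has_real_derivative f1 x) (at x)" "\<And>x. (f1 has_real_derivative f2 x) (at x)"
    and B: "\<And>z. \<bar>z - x\<bar> \<le> \<bar>y\<bar> \<Longrightarrow> \<bar>f2 z\<bar> \<le> B"
  shows "\<bar>f (x + y) - f x - y * f1 x\<bar> \<le> B * y\<^sup>2"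
proof -
  let ?S = "{z. \<bar>z - x\<bar> \<le> \<bar>y\<bar>}"
  have S: "?S = cball x \<bar>y\<bar>" by (auto simp: dist_real_def abs_minus_commute)
  have conv: "convex ?S" unfolding S by (rule convex_cball)
  have B0: "0 \<le> B" using B[of x] by simp
  have f1: "\<bar>f1 z - f1 x\<bar> \<le> B * \<bar>y\<bar>" if "z \<in> ?S" for z
  proof -
    have "norm (f1 z - f1 x) \<le> B * norm (z - x)"
      by (rule field_differentiable_bound[OF conv, where f' = f2])
         (use f(2) B that in \<open>auto intro: DERIV_subset\<close>)
    also have "\<dots> \<le> B * \<bar>y\<bar>" using that B0 by (intro mult_left_mono) auto
    finally show ?thesis by simp
  qed
  have "norm ((f (x + y) - (x + y) * f1 x) - (f x - x * f1 x)) \<le> (B * \<bar>y\<bar>) * norm (x + y - x)"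
  proof (rule field_differentiable_bound[OF conv, where f' = "\<lambda>z. f1 z - f1 x" and f = "\<lambda>z. f z - z * f1 x"])
    show "((\<lambda>z. f z - z * f1 x) has_real_derivative f1 z - f1 x) (at z within ?S)" for z
      by (auto intro!: derivative_eq_intros DERIV_subset[OF f(1)])
  qed (use f1 in auto)
  then show ?thesis by (simp add: algebra_simps power2_eq_square abs_mult_self_eq)
qed

context levy_triplet begin

text \<open>The infinitesimal generator of the process, applied to \<open>f\<close>; the arguments \<open>f1\<close> and \<open>f2\<close> stand for the first
  two derivatives of \<open>f\<close>.\<close>

definition generator :: "(real \<Rightarrow> real) \<Rightarrow> (real \<Rightarrow> real) \<Rightarrow> (real \<Rightarrow> real) \<Rightarrow> real \<Rightarrow> real" where
  "generator f f1 f2 x = \<gamma> * f1 x + \<sigma>\<^sup>2 / 2 * f2 x +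
     (LINT y|\<nu>. f (x + y) - f x - y * indicator {y. \<bar>y\<bar> \<le> 1} y * f1 x)"

text \<open>Exponentials are eigenfunctions of the generator: \<open>iexp (\<theta> * x)\<close> is multiplied by \<open>\<Psi> \<theta>\<close>.\<close>

lemma
  fixes f f1 f2 :: "real \<Rightarrow> real"
  assumes f: "\<And>x. of_real (f x) = (\<Sum>j\<in>J. a j * iexp (\<theta> j * x))"
    and f1: "\<And>x. (f has_real_derivative f1 x) (at x)"
    and f2: "\<And>x. (f1 has_real_derivative f2 x) (at x)"
  shows integrable_generator:
      "integrable \<nu> (\<lambda>y. f (x + y) - f x - y * indicator {y. \<bar>y\<bar> \<le> 1} y * f1 x)"
    and generator_trig_poly:
      "of_real (generator f f1 f2 x) = (\<Sum>j\<in>J. (a j * \<Psi> (\<theta> j)) * iexp (\<theta> j * x))"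
proof -
  let ?g = "\<lambda>y. f (x + y) - f x - y * indicator {y. \<bar>y\<bar> \<le> 1} y * f1 x"
  note F1 = trig_poly_derivative[OF f f1]
  note F2 = trig_poly_derivative[OF F1 f2]
  have g: "of_real (?g y) = (\<Sum>j\<in>J. a j * iexp (\<theta> j * x) * levy_kernel (\<theta> j) y)" for y
  proof -
    have "of_real (?g y) = (\<Sum>j\<in>J. a j * iexp (\<theta> j * (x + y)) - a j * iexp (\<theta> j * x) -
       of_real (y * indicator {y. \<bar>y\<bar> \<le> 1} y) * ((\<i> * of_real (\<theta> j) * a j) * iexp (\<theta> j * x)))"
      unfolding of_real_diff of_real_mult[of _ "f1 x"] f F1 sum_subtractf sum_distrib_left ..
    also have "\<dots> = (\<Sum>j\<in>J. a j * iexp (\<theta> j * x) * levy_kernel (\<theta> j) y)"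
      by (intro sum.cong refl) (simp add: levy_kernel_def algebra_simps exp_add)
    finally show ?thesis .
  qed
  have int: "integrable \<nu> (\<lambda>y. a j * iexp (\<theta> j * x) * levy_kernel (\<theta> j) y)" for j
    by (intro integrable_mult_right integrable_levy_kernel)
  \<comment> \<open>The compensated increment of \<open>f\<close> is a combination of Levy kernels, hence integrable.\<close>
  have "integrable \<nu> (\<lambda>y. complex_of_real (?g y))"
    unfolding g by (intro Bochner_Integration.integrable_sum int)
  from integrable_Re[OF this] show "integrable \<nu> ?g" by simp
  have "of_real (LINT y|\<nu>. ?g y) = (CLINT y|\<nu>. of_real (?g y))"
    by (rule integral_complex_of_real[symmetric])
  also have "\<dots> = (\<Sum>j\<in>J. a j * iexp (\<theta> j * x) * (CLINT y|\<nu>. levy_kernel (\<theta> j) y))"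
    unfolding g by (subst Bochner_Integration.integral_sum[OF int]) simp
  finally have I: "of_real (LINT y|\<nu>. ?g y) = \<dots>" .
  have "of_real (generator f f1 f2 x) = of_real \<gamma> * of_real (f1 x) + of_real (\<sigma>\<^sup>2 / 2) * of_real (f2 x) +
     complex_of_real (LINT y|\<nu>. ?g y)"
    unfolding generator_def of_real_add of_real_mult ..
  also have "\<dots> = (\<Sum>j\<in>J. of_real \<gamma> * ((\<i> * of_real (\<theta> j) * a j) * iexp (\<theta> j * x)) +
     of_real (\<sigma>\<^sup>2 / 2) * ((\<i> * of_real (\<theta> j) * (\<i> * of_real (\<theta> j) * a j)) * iexp (\<theta> j * x)) +
     a j * iexp (\<theta> j * x) * (CLINT y|\<nu>. levy_kernel (\<theta> j) y))"
    unfolding I F1 F2 sum_distrib_left sum.distrib ..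
  also have "\<dots> = (\<Sum>j\<in>J. (a j * \<Psi> (\<theta> j)) * iexp (\<theta> j * x))"
  proof (intro sum.cong refl)
    fix j
    have "\<i> * of_real (\<theta> j) * (\<i> * of_real (\<theta> j) * a j) = - (of_real (\<theta> j))\<^sup>2 * a j"
    proof -
      have "\<i> * of_real (\<theta> j) * (\<i> * of_real (\<theta> j) * a j) = (\<i> * \<i>) * ((of_real (\<theta> j))\<^sup>2 * a j)"
        by (simp only: power2_eq_square mult_ac)
      then show ?thesis by simp
    qed
    then show "of_real \<gamma> * ((\<i> * of_real (\<theta> j) * a j) * iexp (\<theta> j * x)) +
     of_real (\<sigma>\<^sup>2 / 2) * ((\<i> * of_real (\<theta> j) * (\<i> * of_real (\<theta> j) * a j)) * iexp (\<theta> j * x)) +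
     a j * iexp (\<theta> j * x) * (CLINT y|\<nu>. levy_kernel (\<theta> j) y) = (a j * \<Psi> (\<theta> j)) * iexp (\<theta> j * x)"
      by (simp add: exponent_eq algebra_simps power2_eq_square)
  qed
  finally show "of_real (generator f f1 f2 x) = (\<Sum>j\<in>J. (a j * \<Psi> (\<theta> j)) * iexp (\<theta> j * x))" .
qed

end

definition sine_power' :: "nat \<Rightarrow> real \<Rightarrow> real \<Rightarrow> real" where
  "sine_power' k u x = real (2 * k) * (u / 2) * sin (u * x / 2) ^ (2 * k - 1) * cos (u * x / 2)"

definition sine_power'' :: "nat \<Rightarrow> real \<Rightarrow> real \<Rightarrow> real" where
  "sine_power'' k u x = real (2 * k) * (u / 2)\<^sup>2 *
     (real (2 * k - 1) * sin (u * x / 2) ^ (2 * k - 2) * (cos (u * x / 2))\<^sup>2 - sin (u * x / 2) ^ (2 * k))"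

lemma sine_power_deriv: "(sine_power k u has_real_derivative sine_power' k u x) (at x)"
  unfolding sine_power_def sine_power'_def by (auto intro!: derivative_eq_intros simp: algebra_simps)

lemma sine_power'_deriv:
  assumes "0 < k"
  shows "(sine_power' k u has_real_derivative sine_power'' k u x) (at x)"
proof -
  obtain m where m: "2 * k = Suc (Suc m)" using assms by (cases k) auto
  let ?s = "sin (u * x / 2)" and ?c = "cos (u * x / 2)"
  have "((\<lambda>x. sin (u * x / 2) ^ Suc m) has_real_derivative real (Suc m) * (?c * (u / 2)) * ?s ^ m) (at x)"
    by (rule DERIV_cong[OF DERIV_power[where D = "?c * (u / 2)"]]) (auto intro!: derivative_eq_intros)
  moreover have "((\<lambda>x. cos (u * x / 2)) has_real_derivative - ?s * (u / 2)) (at x)"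
    by (auto intro!: derivative_eq_intros)
  ultimately have "((\<lambda>x. sin (u * x / 2) ^ Suc m * cos (u * x / 2)) has_real_derivative
      real (Suc m) * (?c * (u / 2)) * ?s ^ m * ?c + - ?s * (u / 2) * ?s ^ Suc m) (at x)"
    by (rule DERIV_mult)
  from DERIV_cmult[OF this, of "real (Suc (Suc m)) * (u / 2)"]
  have "(sine_power' k u has_real_derivative real (Suc (Suc m)) * (u / 2) *
      (real (Suc m) * (?c * (u / 2)) * ?s ^ m * ?c + - ?s * (u / 2) * ?s ^ Suc m)) (at x)"
    unfolding sine_power'_def[abs_def] m by (simp add: mult.assoc)
  moreover have "real (Suc (Suc m)) * (u / 2) *
      (real (Suc m) * (?c * (u / 2)) * ?s ^ m * ?c + - ?s * (u / 2) * ?s ^ Suc m) =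
      real (Suc (Suc m)) * (u / 2)\<^sup>2 * (real (Suc m) * ?s ^ m * ?c\<^sup>2 - ?s ^ Suc (Suc m))"
  proof -
    have "N * w * (a * (c * w) * p * c + - s * w * (s * p)) = N * w\<^sup>2 * (a * p * c\<^sup>2 - s * (s * p))"
      for N w a c s p :: real by algebra
    then show ?thesis unfolding power_Suc .
  qed
  ultimately have "(sine_power' k u has_real_derivative
      real (Suc (Suc m)) * (u / 2)\<^sup>2 * (real (Suc m) * ?s ^ m * ?c\<^sup>2 - ?s ^ Suc (Suc m))) (at x)"
    by (rule DERIV_cong)
  then show ?thesis unfolding sine_power''_def m by simp
qed

lemma sine_power_trig_poly:
  "of_real (sine_power k u x) = (\<Sum>j\<le>2*k. ((1 / (2 * \<i>)) ^ (2*k) * of_nat ((2*k) choose j) * (-1) ^ (2*k - j)) *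
     iexp ((u / 2 * (2 * real j - real (2*k))) * x))"
  unfolding sine_power_def by (rule sin_power_trig_poly)

lemma abs_sine_power'_le:
  assumes "0 < k" "0 < u"
  shows "\<bar>sine_power' k u x\<bar> \<le> real (2 * k) * (sine_power k u x + u ^ (2 * k))"
proof -
  define s where "s = \<bar>sin (u * x / 2)\<bar>"
  have s: "sine_power k u x = s ^ (2 * k)" by (simp add: sine_power_def s_def power_even_abs)
  have "\<bar>sine_power' k u x\<bar> = real (2 * k) * ((u / 2) * s ^ (2 * k - 1) * \<bar>cos (u * x / 2)\<bar>)"
    using assms by (simp add: sine_power'_def abs_mult power_abs s_def)
  also have "(u / 2) * s ^ (2 * k - 1) * \<bar>cos (u * x / 2)\<bar> \<le> u * s ^ (2 * k - 1) * 1"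
    using assms by (intro mult_mono) (auto simp: s_def)
  also have "u * s ^ (2 * k - 1) * 1 \<le> s ^ (2 * k) + u ^ (2 * k)"
    using young_power[of s u "2 * k - 1" 1] assms by (simp add: s_def mult_ac)
  finally show ?thesis by (simp add: s mult_left_mono)
qed

lemma abs_sine_power''_le:
  assumes "0 < k"
  shows "\<bar>sine_power'' k u x\<bar> \<le> (real (2 * k))\<^sup>2 * u\<^sup>2 * \<bar>sin (u * x / 2)\<bar> ^ (2 * k - 2)"
proof -
  define s where "s = \<bar>sin (u * x / 2)\<bar>"
  define N where "N = real (2 * k)"
  have N: "N \<ge> 1" using assms by (simp add: N_def)
  have s: "0 \<le> s" "s \<le> 1" by (simp_all add: s_def)
  define a where "a = s ^ (2 * k - 2)"
  have a: "0 \<le> a" using s by (simp add: a_def)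
  have e: "sin (u * x / 2) ^ (2 * k - 2) = a" "sin (u * x / 2) ^ (2 * k) = s ^ (2 * k)"
    by (simp_all add: a_def s_def power_even_abs)
  have sa: "s ^ (2 * k) \<le> a" unfolding a_def using s by (intro power_decreasing) auto
  have "0 \<le> a * (cos (u * x / 2))\<^sup>2" "a * (cos (u * x / 2))\<^sup>2 \<le> a * 1"
    using a by (auto intro!: mult_left_le simp: abs_square_le_1)
  then have "0 \<le> (N - 1) * (a * (cos (u * x / 2))\<^sup>2)" "(N - 1) * (a * (cos (u * x / 2))\<^sup>2) \<le> (N - 1) * a"
    using N by (auto intro!: mult_left_mono)
  moreover have "0 \<le> s ^ (2 * k)" using s by simp
  ultimately have "\<bar>(N - 1) * (a * (cos (u * x / 2))\<^sup>2) - s ^ (2 * k)\<bar> \<le> N * a"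
    using sa N a by (auto simp: abs_le_iff algebra_simps intro: add_increasing mult_right_mono) 
  then have "N * (u / 2)\<^sup>2 * \<bar>(N - 1) * (a * (cos (u * x / 2))\<^sup>2) - s ^ (2 * k)\<bar> \<le> N * u\<^sup>2 * (N * a)"
    using N by (intro mult_mono) (auto simp: power_divide)
  moreover have "sine_power'' k u x = N * (u / 2)\<^sup>2 * ((N - 1) * (a * (cos (u * x / 2))\<^sup>2) - s ^ (2 * k))"
  proof -
    have "real (2 * k - 1) = N - 1" using assms by (simp add: N_def of_nat_diff)
    then show ?thesis by (simp only: sine_power''_def e mult.assoc flip: N_def)
  qed
  ultimately have "\<bar>sine_power'' k u x\<bar> \<le> N * u\<^sup>2 * (N * a)"
    using N by (simp add: abs_mult)
  also have "\<dots> = N\<^sup>2 * u\<^sup>2 * a" by (simp add: power2_eq_square)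
  finally show ?thesis by (simp only: N_def a_def s_def)
qed

text \<open>The second derivative at a point \<open>z\<close> between \<open>x\<close> and \<open>x + y\<close> is of size \<open>u\<^sup>2 \<bar>sin (u z / 2)\<bar> ^ (2k - 2)\<close>. Since
  \<open>\<bar>sin (u z / 2)\<bar> \<le> \<bar>sin (u x / 2)\<bar> + u\<close> for \<open>\<bar>y\<bar> \<le> 1\<close>, it is controlled by the value of the function at \<open>x\<close> itself.\<close>

lemma sine_power_second_difference:
  assumes k: "0 < k" and u: "0 < u" and y: "\<bar>y\<bar> \<le> 1"
  shows "sine_power k u (x + y) - sine_power k u x - y * sine_power' k u x \<le>
    ((real (2 * k))\<^sup>2 * 2 ^ (2 * k)) * (sine_power k u x + 2 * u ^ (2 * k)) * y\<^sup>2"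
proof -
  define s where "s = \<bar>sin (u * x / 2)\<bar>"
  define n where "n = 2 * k - 2"
  have n: "2 * k = n + 2" using k by (simp add: n_def)
  have s: "sine_power k u x = s ^ (2 * k)" "0 \<le> s" by (simp_all add: sine_power_def s_def power_even_abs)
  have "\<bar>sine_power'' k u z\<bar> \<le> (real (2 * k))\<^sup>2 * 2 ^ (2 * k) * (sine_power k u x + 2 * u ^ (2 * k))"
    if "\<bar>z - x\<bar> \<le> \<bar>y\<bar>" for z
  proof -
    have "\<bar>sin (u * z / 2)\<bar> \<le> s + \<bar>sin (u * (z - x) / 2)\<bar>"
      using abs_sin_add_le[of "u * x / 2" "u * (z - x) / 2"] unfolding s_def
      by (simp add: field_simps)
    also have "\<bar>sin (u * (z - x) / 2)\<bar> \<le> u * \<bar>z - x\<bar>"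
      using abs_sin_x_le_abs_x[of "u * (z - x) / 2"] u by (simp add: abs_mult)
    also have "u * \<bar>z - x\<bar> \<le> u" using that y u by simp
    finally have "\<bar>sin (u * z / 2)\<bar> ^ n \<le> (s + u) ^ n" by (intro power_mono) auto
    also have "\<dots> \<le> 2 ^ n * (s ^ n + u ^ n)" using s u by (intro power_add_le) auto
    also have "\<dots> \<le> 2 ^ (2 * k) * (s ^ n + u ^ n)"
      using s u by (intro mult_right_mono power_increasing) (auto simp: n)
    finally have "u\<^sup>2 * \<bar>sin (u * z / 2)\<bar> ^ n \<le> u\<^sup>2 * (2 ^ (2 * k) * (s ^ n + u ^ n))"
      by (rule mult_left_mono) simp
    also have "\<dots> = 2 ^ (2 * k) * (s ^ n * u\<^sup>2 + u ^ (2 * k))"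
      unfolding n power_add by algebra
    also have "\<dots> \<le> 2 ^ (2 * k) * (sine_power k u x + 2 * u ^ (2 * k))"
      using young_power[of s u n 2] s u by (intro mult_left_mono) (auto simp: n)
    finally have "(real (2 * k))\<^sup>2 * (u\<^sup>2 * \<bar>sin (u * z / 2)\<bar> ^ n) \<le>
        (real (2 * k))\<^sup>2 * (2 ^ (2 * k) * (sine_power k u x + 2 * u ^ (2 * k)))"
      by (rule mult_left_mono) simp
    then show ?thesis using abs_sine_power''_le[OF k, of u z] by (simp add: n_def mult_ac)
  qed
  from second_order_bound[OF sine_power_deriv sine_power'_deriv[OF k] this]
  show ?thesis by (auto simp: abs_le_iff)
qed

lemma sine_power_add_le:
  assumes "0 < u" "0 < r" "r \<le> 2 * real k"
  shows "sine_power k u (x + y) \<le> 2 ^ (2 * k) * (sine_power k u x + u powr r * \<bar>y\<bar> powr r)"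
proof -
  have "sine_power k u (x + y) = \<bar>sin (u * x / 2 + u * y / 2)\<bar> ^ (2 * k)"
    by (simp add: sine_power_def power_even_abs algebra_simps add_divide_distrib)
  also have "\<dots> \<le> (\<bar>sin (u * x / 2)\<bar> + \<bar>sin (u * y / 2)\<bar>) ^ (2 * k)"
    by (intro power_mono abs_sin_add_le) auto
  also have "\<dots> \<le> 2 ^ (2 * k) * (\<bar>sin (u * x / 2)\<bar> ^ (2 * k) + \<bar>sin (u * y / 2)\<bar> ^ (2 * k))"
    by (intro power_add_le) auto
  also have "\<dots> = 2 ^ (2 * k) * (sine_power k u x + sine_power k u y)"
    by (simp add: sine_power_def power_even_abs)
  also have "\<dots> \<le> 2 ^ (2 * k) * (sine_power k u x + u powr r * \<bar>y\<bar> powr r)"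
    using sine_power_le_powr[OF assms, of y] by simp
  finally show ?thesis .
qed

context levy_triplet begin

text \<open>Drift, Gaussian part and small jumps only produce \<open>sine_power k u x\<close> and errors of order \<open>u ^ (2 * k)\<close>.
  The error \<open>u powr r\<close> comes from the large jumps, to which subadditivity is applied. The constants do not
  depend on \<open>u\<close>, which makes the bound an inequality of Gronwall type that is uniform in \<open>u\<close>.\<close>

lemma generator_sine_power_le:
  assumes k: "0 < k" and r: "0 < r" "r \<le> 2 * real k" and mom: "large_moment r"
  obtains A B where "0 \<le> A" "0 \<le> B"
    "\<And>u x. 0 < u \<Longrightarrow> generator (sine_power k u) (sine_power' k u) (sine_power'' k u) x \<le>
       A * sine_power k u x + B * (u ^ (2 * k) + u powr r)"
proof -
  define N where "N = real (2 * k)"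
  define m2 where "m2 = (LINT y|\<nu>. \<bar>y\<bar> powr 2 * indicator {y. \<bar>y\<bar> \<le> 1} y)"
  define \<Lambda> where "\<Lambda> = (LINT y|\<nu>. indicator {y. 1 < \<bar>y\<bar>} y :: real)"
  define mr where "mr = (LINT y|\<nu>. \<bar>y\<bar> powr r * indicator {y. 1 < \<bar>y\<bar>} y)"
  have nn: "0 \<le> N" "0 \<le> m2" "0 \<le> \<Lambda>" "0 \<le> mr" by (simp_all add: N_def m2_def \<Lambda>_def mr_def)
  define c where "c = N\<^sup>2 * 2 ^ (2 * k)"
  have c: "0 \<le> c" by (simp add: c_def)
  define A where "A = \<bar>\<gamma>\<bar> * N + \<sigma>\<^sup>2 * N\<^sup>2 + c * m2 + 2 ^ (2 * k) * \<Lambda>"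
  define B where "B = \<bar>\<gamma>\<bar> * N + \<sigma>\<^sup>2 * N\<^sup>2 + 2 * (c * m2) + 2 ^ (2 * k) * mr"
  show thesis
  proof
    show "0 \<le> A" "0 \<le> B" using nn c by (simp_all add: A_def B_def)
    fix u x :: real assume u: "0 < u"
    define f where "f = sine_power k u x"
    define U where "U = u ^ (2 * k)"
    define R where "R = u powr r"
    have fU: "0 \<le> f" "0 \<le> U" "0 \<le> R" using u by (simp_all add: f_def U_def R_def sine_power_bounds)
    have drift: "\<gamma> * sine_power' k u x \<le> \<bar>\<gamma>\<bar> * (N * (f + U))"
    proof -
      have "\<gamma> * sine_power' k u x \<le> \<bar>\<gamma>\<bar> * \<bar>sine_power' k u x\<bar>" by (simp flip: abs_mult)
      also have "\<dots> \<le> \<bar>\<gamma>\<bar> * (N * (f + U))"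
        unfolding N_def f_def U_def by (intro mult_left_mono abs_sine_power'_le k u) auto
      finally show ?thesis .
    qed
    have gauss: "\<sigma>\<^sup>2 / 2 * sine_power'' k u x \<le> \<sigma>\<^sup>2 * (N\<^sup>2 * (f + U))"
    proof -
      define s where "s = \<bar>sin (u * x / 2)\<bar>"
      have "sine_power'' k u x \<le> \<bar>sine_power'' k u x\<bar>" by simp
      also have "\<dots> \<le> N\<^sup>2 * (s ^ (2 * k - 2) * u\<^sup>2)"
        using abs_sine_power''_le[OF k, of u x] by (simp add: N_def s_def mult_ac)
      also have "\<dots> \<le> N\<^sup>2 * (f + U)"
      proof (intro mult_left_mono)
        have "2 * k - 2 + 2 = 2 * k" using k by simp
        with young_power[of s u "2 * k - 2" 2] u show "s ^ (2 * k - 2) * u\<^sup>2 \<le> f + U"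
          by (simp only: f_def U_def s_def sine_power_def power_even_abs even_mult_iff) (simp add: power_even_abs)
      qed simp
      finally have "\<sigma>\<^sup>2 / 2 * sine_power'' k u x \<le> \<sigma>\<^sup>2 / 2 * (N\<^sup>2 * (f + U))"
        by (rule mult_left_mono) simp
      also have "\<dots> \<le> \<sigma>\<^sup>2 * (N\<^sup>2 * (f + U))"
        using fU by (intro mult_right_mono) auto
      finally show ?thesis .
    qed
    have "(LINT y|\<nu>. sine_power k u (x + y) - sine_power k u x - y * indicator {y. \<bar>y\<bar> \<le> 1} y * sine_power' k u x) \<le>
        (LINT y|\<nu>. c * (f + 2 * U) * (\<bar>y\<bar> powr 2 * indicator {y. \<bar>y\<bar> \<le> 1} y) +
          (2 ^ (2 * k) * f * indicator {y. 1 < \<bar>y\<bar>} y + 2 ^ (2 * k) * R * (\<bar>y\<bar> powr r * indicator {y. 1 < \<bar>y\<bar>} y)))"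
    proof (rule integral_mono)
      show "integrable \<nu> (\<lambda>y. sine_power k u (x + y) - sine_power k u x - y * indicator {y. \<bar>y\<bar> \<le> 1} y * sine_power' k u x)"
        by (rule integrable_generator[OF sine_power_trig_poly sine_power_deriv sine_power'_deriv[OF k]])
      show "integrable \<nu> (\<lambda>y. c * (f + 2 * U) * (\<bar>y\<bar> powr 2 * indicator {y. \<bar>y\<bar> \<le> 1} y) +
          (2 ^ (2 * k) * f * indicator {y. 1 < \<bar>y\<bar>} y + 2 ^ (2 * k) * R * (\<bar>y\<bar> powr r * indicator {y. 1 < \<bar>y\<bar>} y)))"
        by (intro Bochner_Integration.integrable_add integrable_mult_right integrable_large_jumps
          small_moment_2[unfolded small_moment_def] mom[unfolded large_moment_def])
      fix y :: real
      show "sine_power k u (x + y) - sine_power k u x - y * indicator {y. \<bar>y\<bar> \<le> 1} y * sine_power' k u x \<le>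
        c * (f + 2 * U) * (\<bar>y\<bar> powr 2 * indicator {y. \<bar>y\<bar> \<le> 1} y) +
          (2 ^ (2 * k) * f * indicator {y. 1 < \<bar>y\<bar>} y + 2 ^ (2 * k) * R * (\<bar>y\<bar> powr r * indicator {y. 1 < \<bar>y\<bar>} y))"
      proof (cases "\<bar>y\<bar> \<le> 1")
        case True
        then show ?thesis using sine_power_second_difference[OF k u True, of x]
          by (simp add: c_def N_def f_def U_def)
      next
        case False
        then show ?thesis using sine_power_add_le[OF u r, of x y] sine_power_bounds[of k u x]
          by (simp add: f_def R_def algebra_simps)
      qed
    qed
    also have "\<dots> = c * (f + 2 * U) * m2 + (2 ^ (2 * k) * f * \<Lambda> + 2 ^ (2 * k) * R * mr)"
      using integrable_large_jumps small_moment_2[unfolded small_moment_def] mom[unfolded large_moment_def]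
      unfolding m2_def \<Lambda>_def mr_def
      by (subst Bochner_Integration.integral_add, simp, simp)+ (simp only: integral_mult_right_zero)
    finally have "generator (sine_power k u) (sine_power' k u) (sine_power'' k u) x \<le>
        \<bar>\<gamma>\<bar> * (N * (f + U)) + \<sigma>\<^sup>2 * (N\<^sup>2 * (f + U)) + (c * (f + 2 * U) * m2 + (2 ^ (2 * k) * f * \<Lambda> + 2 ^ (2 * k) * R * mr))"
      unfolding generator_def using drift gauss by linarith
    also have "\<dots> = A * f + (B - 2 ^ (2 * k) * mr) * U + 2 ^ (2 * k) * mr * R"
      by (simp add: A_def B_def algebra_simps)
    also have "\<dots> \<le> A * f + B * U + B * R"
      using fU nn c by (intro add_mono mult_right_mono) (auto simp: B_def)
    finally show "generator (sine_power k u) (sine_power' k u) (sine_power'' k u) x \<le>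
       A * sine_power k u x + B * (u ^ (2 * k) + u powr r)"
      by (simp add: f_def U_def R_def algebra_simps)
  qed
qed

text \<open>The derivatives of order below \<open>2 * k\<close> vanish at 0, so the Gaussian part is seen only for \<open>k = 1\<close>.\<close>

lemma generator_sine_power_0:
  assumes "0 < k"
  shows "generator (sine_power k u) (sine_power' k u) (sine_power'' k u) 0 =
    (if k = 1 then \<sigma>\<^sup>2 * u\<^sup>2 / 4 else 0) + (LINT y|\<nu>. sine_power k u y)"
proof -
  have "sine_power' k u 0 = 0" "sine_power k u 0 = 0"
    "sine_power'' k u 0 = (if k = 1 then u\<^sup>2 / 2 else 0)"
    using assms by (auto simp: sine_power_def sine_power'_def sine_power''_def power_0_left power2_eq_square)
  then show ?thesis by (simp add: generator_def)
qed

lemma integrable_sine_power: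
  assumes "0 < k"
  shows "integrable \<nu> (sine_power k u)"
proof -
  have "sine_power' k u 0 = 0" "sine_power k u 0 = 0"
    using assms by (auto simp: sine_power_def sine_power'_def power_0_left)
  with integrable_generator[where f = "sine_power k u" and x = 0, OF sine_power_trig_poly sine_power_deriv sine_power'_deriv[OF assms]]
  show ?thesis by simp
qed

end

section \<open>Sine moments of the marginals\<close>

text \<open>The half-angle formula \<open>sin (y / 2) ^ 2 = (1 - cos y) / 2\<close>.\<close>

lemma (in prob_space) expectation_sine_power_1:
  assumes [measurable]: "Y \<in> borel_measurable M"
  shows "expectation (\<lambda>\<omega>. sine_power 1 u (Y \<omega>)) = (1 - Re (CLINT \<omega>|M. iexp (u * Y \<omega>))) / 2"
proof -
  have i: "integrable M (\<lambda>\<omega>. iexp (u * Y \<omega>))"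
    by (intro integrable_const_bound[of _ 1]) auto
  have "sine_power 1 u x = (1 - Re (iexp (u * x))) / 2" for x
    using cos_double_sin[of "u * x / 2"] by (simp add: sine_power_def Re_exp)
  then have "expectation (\<lambda>\<omega>. sine_power 1 u (Y \<omega>)) = expectation (\<lambda>\<omega>. (1 - Re (iexp (u * Y \<omega>))) / 2)"
    by (simp only:)
  also have "\<dots> = (1 - expectation (\<lambda>\<omega>. Re (iexp (u * Y \<omega>)))) / 2"
    using integrable_Re[OF i] by (simp add: prob_space)
  finally show ?thesis by (simp only: integral_Re[OF i])
qed

text \<open>The information about the process from which all limits are derived: its one-dimensional
  characteristic functions.\<close>

locale levy_marginals = levy_triplet \<gamma> \<sigma> \<nu> + prob_space M
  for \<gamma> \<sigma> :: real and \<nu> :: "real measure" and M :: "'a measure" +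
  fixes X :: "real \<Rightarrow> 'a \<Rightarrow> real"
  assumes X_measurable: "0 \<le> t \<Longrightarrow> X t \<in> borel_measurable M"
    and char_X: "0 \<le> t \<Longrightarrow> (CLINT \<omega>|M. iexp (\<zeta> * X t \<omega>)) = exp (of_real t * \<Psi> \<zeta>)"
begin

lemma
  fixes g :: "real \<Rightarrow> real"
  assumes g: "\<And>x. of_real (g x) = (\<Sum>j\<in>J. b j * iexp (\<theta> j * x))" and t: "0 \<le> t"
  shows integrable_trig_poly: "integrable M (\<lambda>\<omega>. g (X t \<omega>))"
    and expectation_trig_poly: "expectation (\<lambda>\<omega>. g (X t \<omega>)) = Re (\<Sum>j\<in>J. b j * exp (of_real t * \<Psi> (\<theta> j)))"
proof -
  note X_measurable[OF t, measurable]
  have int: "integrable M (\<lambda>\<omega>. b j * iexp (\<theta> j * X t \<omega>))" for j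
    by (intro integrable_mult_right integrable_const_bound[of _ 1]) auto
  have i: "integrable M (\<lambda>\<omega>. complex_of_real (g (X t \<omega>)))"
    unfolding g by (intro Bochner_Integration.integrable_sum int)
  from integrable_Re[OF this] show "integrable M (\<lambda>\<omega>. g (X t \<omega>))" by simp
  have "expectation (\<lambda>\<omega>. g (X t \<omega>)) = Re (CLINT \<omega>|M. complex_of_real (g (X t \<omega>)))" by simp
  also have "(CLINT \<omega>|M. complex_of_real (g (X t \<omega>))) = (\<Sum>j\<in>J. b j * exp (of_real t * \<Psi> (\<theta> j)))"
    unfolding g by (subst Bochner_Integration.integral_sum[OF int]) (simp only: integral_mult_right_zero char_X[OF t])
  finally show "expectation (\<lambda>\<omega>. g (X t \<omega>)) = Re (\<Sum>j\<in>J. b j * exp (of_real t * \<Psi> (\<theta> j)))" .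
qed

text \<open>Dynkin's formula in differential form. Both sides are finite combinations of the functions
  \<open>exp (t * \<Psi> (\<theta> j))\<close>, and differentiation in \<open>t\<close> produces the factor \<open>\<Psi> (\<theta> j)\<close> by which the generator acts on
  \<open>iexp (\<theta> j * x)\<close>.\<close>

lemma dynkin_trig_poly:
  fixes f f1 f2 :: "real \<Rightarrow> real"
  assumes f: "\<And>x. of_real (f x) = (\<Sum>j\<in>J. a j * iexp (\<theta> j * x))"
    and f1: "\<And>x. (f has_real_derivative f1 x) (at x)"
    and f2: "\<And>x. (f1 has_real_derivative f2 x) (at x)"
    and t: "0 \<le> t"
  shows "((\<lambda>t. expectation (\<lambda>\<omega>. f (X t \<omega>))) has_real_derivative
           expectation (\<lambda>\<omega>. generator f f1 f2 (X t \<omega>))) (at t within {0..})"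
proof -
  note G = generator_trig_poly[OF f f1 f2]
  have "((\<lambda>t. exp (of_real t * \<Psi> (\<theta> j))) has_vector_derivative \<Psi> (\<theta> j) * exp (of_real t * \<Psi> (\<theta> j))) (at t within {0..})" for j
  proof -
    have "((\<lambda>z. exp (z * \<Psi> (\<theta> j))) has_field_derivative \<Psi> (\<theta> j) * exp (of_real t * \<Psi> (\<theta> j))) (at (of_real t))"
      by (auto intro!: derivative_eq_intros)
    from has_vector_derivative_real_field[OF this] show ?thesis .
  qed
  then have "((\<lambda>t. \<Sum>j\<in>J. a j * exp (of_real t * \<Psi> (\<theta> j))) has_vector_derivative
      (\<Sum>j\<in>J. a j * (\<Psi> (\<theta> j) * exp (of_real t * \<Psi> (\<theta> j))))) (at t within {0..})"
    by (intro has_vector_derivative_sum bounded_linear.has_vector_derivative[OF bounded_linear_mult_right])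
  from bounded_linear.has_vector_derivative[OF bounded_linear_Re this]
  have "((\<lambda>t. Re (\<Sum>j\<in>J. a j * exp (of_real t * \<Psi> (\<theta> j)))) has_real_derivative
      Re (\<Sum>j\<in>J. a j * \<Psi> (\<theta> j) * exp (of_real t * \<Psi> (\<theta> j)))) (at t within {0..})"
    by (simp only: has_real_derivative_iff_has_vector_derivative mult.assoc)
  then have "((\<lambda>t. expectation (\<lambda>\<omega>. f (X t \<omega>))) has_real_derivative
      Re (\<Sum>j\<in>J. a j * \<Psi> (\<theta> j) * exp (of_real t * \<Psi> (\<theta> j)))) (at t within {0..})"
    by (rule has_field_derivative_transform_within[of _ _ _ _ 1])
       (use t in \<open>auto simp: expectation_trig_poly[OF f]\<close>)
  then show ?thesis by (simp only: expectation_trig_poly[OF G t])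
qed

definition sine_moment :: "nat \<Rightarrow> real \<Rightarrow> real \<Rightarrow> real" where
  "sine_moment k u t = expectation (\<lambda>\<omega>. sine_power k u (X t \<omega>))"

lemma integrable_sine_moment: "0 \<le> t \<Longrightarrow> integrable M (\<lambda>\<omega>. sine_power k u (X t \<omega>))"
  by (rule integrable_trig_poly[OF sine_power_trig_poly])

lemma sine_moment_at_0:
  assumes "0 < k"
  shows "sine_moment k u 0 = 0"
proof -
  have "complex_of_real (sine_power k u 0) = 0" using assms by (simp add: sine_power_def power_0_left)
  then show ?thesis
    unfolding sine_moment_def by (subst expectation_trig_poly[OF sine_power_trig_poly]) (simp_all add: sine_power_trig_poly)
qed

text \<open>Gronwall's inequality for \<open>t \<mapsto> sine_moment k u t\<close>, which starts at 0. This is the estimate of the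
  moments for small \<open>u\<close>; it is linear in \<open>t\<close>, and because it holds for all \<open>u > 0\<close> it remains useful at
  \<open>u = v / sqrt t\<close>.\<close>

lemma sine_moment_le:
  assumes k: "0 < k" and r: "0 < r" "r \<le> 2 * real k" and mom: "large_moment r"
  obtains C where "0 \<le> C"
    "\<And>u t. 0 < u \<Longrightarrow> 0 \<le> t \<Longrightarrow> t \<le> 1 \<Longrightarrow> sine_moment k u t \<le> C * t * (u ^ (2 * k) + u powr r)"
proof -
  obtain A B where AB: "0 \<le> A" "0 \<le> B"
    "\<And>u x. 0 < u \<Longrightarrow> generator (sine_power k u) (sine_power' k u) (sine_power'' k u) x \<le>
       A * sine_power k u x + B * (u ^ (2 * k) + u powr r)"
    using generator_sine_power_le[OF assms] by blast
  show thesis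
  proof
    show "0 \<le> B * exp A" using AB by simp
    fix u t :: real assume u: "0 < u" and t: "0 \<le> t" "t \<le> 1"
    define D where "D = B * (u ^ (2 * k) + u powr r)"
    have D: "0 \<le> D" using u AB by (simp add: D_def)
    have "sine_moment k u t \<le> D * t * exp (A * t)"
    proof (rule gronwall_affine[where h' = "\<lambda>t. expectation (\<lambda>\<omega>. generator (sine_power k u) (sine_power' k u) (sine_power'' k u) (X t \<omega>))"])
      fix t :: real assume t: "0 \<le> t"
      show "(sine_moment k u has_real_derivative
          expectation (\<lambda>\<omega>. generator (sine_power k u) (sine_power' k u) (sine_power'' k u) (X t \<omega>))) (at t within {0..})"
        unfolding sine_moment_def[abs_def]
        by (rule dynkin_trig_poly[OF sine_power_trig_poly sine_power_deriv sine_power'_deriv[OF k] t])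
      have "expectation (\<lambda>\<omega>. generator (sine_power k u) (sine_power' k u) (sine_power'' k u) (X t \<omega>)) \<le>
          expectation (\<lambda>\<omega>. A * sine_power k u (X t \<omega>) + D)"
      proof (rule integral_mono)
        show "integrable M (\<lambda>\<omega>. generator (sine_power k u) (sine_power' k u) (sine_power'' k u) (X t \<omega>))"
          by (rule integrable_trig_poly[OF generator_trig_poly[OF sine_power_trig_poly sine_power_deriv sine_power'_deriv[OF k]] t])
        show "integrable M (\<lambda>\<omega>. A * sine_power k u (X t \<omega>) + D)"
          using integrable_sine_moment[OF t] by simp
      qed (use AB(3)[OF u] in \<open>simp add: D_def\<close>)
      also have "\<dots> = A * sine_moment k u t + D"
        using integrable_sine_moment[OF t, of k u] by (simp add: sine_moment_def prob_space)
      finally show "expectation (\<lambda>\<omega>. generator (sine_power k u) (sine_power' k u) (sine_power'' k u) (X t \<omega>)) \<le>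
          A * sine_moment k u t + D" .
    qed (use AB D t sine_moment_at_0[OF k] in auto)
    also have "\<dots> \<le> D * t * exp A"
      using D t AB mult_left_le[of t A] by (intro mult_left_mono) auto
    finally show "sine_moment k u t \<le> B * exp A * t * (u ^ (2 * k) + u powr r)"
      by (simp add: D_def mult_ac)
  qed
qed

text \<open>This is the derivative at time 0, that is, the generator evaluated at the starting point 0.\<close>

lemma sine_moment_div_tendsto:
  assumes k: "0 < k"
  shows "((\<lambda>t. sine_moment k u t / t) \<longlongrightarrow>
    (if k = 1 then \<sigma>\<^sup>2 * u\<^sup>2 / 4 else 0) + (LINT y|\<nu>. sine_power k u y)) (at_right 0)"
proof -
  let ?G = "generator (sine_power k u) (sine_power' k u) (sine_power'' k u)"
  note G = generator_trig_poly[OF sine_power_trig_poly sine_power_deriv sine_power'_deriv[OF k]]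
  have "(sine_moment k u has_real_derivative expectation (\<lambda>\<omega>. ?G (X 0 \<omega>))) (at 0 within {0..})"
    unfolding sine_moment_def[abs_def]
    by (rule dynkin_trig_poly[OF sine_power_trig_poly sine_power_deriv sine_power'_deriv[OF k]]) simp
  moreover have "expectation (\<lambda>\<omega>. ?G (X 0 \<omega>)) = Re (of_real (?G 0))"
    by (subst expectation_trig_poly[OF G], simp, subst G) simp
  ultimately have "(sine_moment k u has_real_derivative ?G 0) (at 0 within {0<..})"
    by (auto intro: DERIV_subset)
  then show ?thesis
    by (simp add: has_field_derivative_iff sine_moment_at_0[OF k] generator_sine_power_0[OF k])
qed

lemma sine_moment_1: "0 \<le> t \<Longrightarrow> sine_moment 1 u t = (1 - Re (exp (of_real t * \<Psi> u))) / 2"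
  unfolding sine_moment_def by (simp only: expectation_sine_power_1[OF X_measurable] char_X)

lemma sine_moment_le_1: "0 < k \<Longrightarrow> 0 \<le> t \<Longrightarrow> sine_moment k u t \<le> sine_moment 1 u t"
  unfolding sine_moment_def
proof (intro integral_mono integrable_sine_moment)
  fix \<omega> assume "0 < k"
  then have "\<bar>sin (u * X t \<omega> / 2)\<bar> ^ (2 * k) \<le> \<bar>sin (u * X t \<omega> / 2)\<bar> ^ (2 * 1)"
    by (intro power_decreasing) auto
  then show "sine_power k u (X t \<omega>) \<le> sine_power 1 u (X t \<omega>)"
    by (simp add: sine_power_def power_even_abs)
qed auto

lemma nn_integral_sine_power:
  assumes "0 \<le> t"
  shows "(\<integral>\<^sup>+\<omega>. ennreal (sine_power k u (X t \<omega>)) \<partial>M) = ennreal (sine_moment k u t)"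
  unfolding sine_moment_def
  by (rule nn_integral_eq_integral[OF integrable_sine_moment[OF assms]]) (simp add: sine_power_bounds)

lemma sine_moment_le_exponent:
  assumes "0 < k" "0 \<le> t"
  shows "sine_moment k u t \<le> t * cmod (\<Psi> u)"
proof -
  have "1 - Re (exp (of_real t * \<Psi> u)) \<le> cmod (of_real t * \<Psi> u)"
    using Re_exponent_le_0[of u] assms by (intro one_minus_Re_exp_le) (simp add: mult_nonneg_nonpos)
  moreover have "cmod (of_real t * \<Psi> u) = t * cmod (\<Psi> u)" using assms by (simp add: norm_mult)
  moreover have "a / 2 \<le> b" if "a \<le> b" "0 \<le> b" for a b :: real using that by linarith
  ultimately have "sine_moment 1 u t \<le> t * cmod (\<Psi> u)"
    unfolding sine_moment_1[OF assms(2)] using assms(2) by (simp only: mult_nonneg_nonneg norm_ge_zero)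
  then show ?thesis using sine_moment_le_1[OF assms] by (rule order_trans[rotated])
qed

end

section \<open>Moments of order t\<close>

context levy_marginals begin

text \<open>The common core of all regimes of order \<open>t\<close>. The exponent \<open>k\<close> is taken at least 2, so that drift and
  Gaussian part leave no trace in the pointwise limit; that they are negligible at all is expressed by
  the growth assumption with \<open>p < q\<close>.\<close>

lemma moment_div_tendsto_jump_moment:
  assumes q: "0 < q" "p < q" "q < r" and mom: "large_moment r"
    and growth: "\<And>u. 1 \<le> u \<Longrightarrow> cmod (\<Psi> u) \<le> C * u powr p"
  shows "((\<lambda>t. ennreal (1 / t) * abs_moment M (X t) q) \<longlongrightarrow> (\<integral>\<^sup>+x. ennreal (\<bar>x\<bar> powr q) \<partial>\<nu>)) (at_right 0)"
proof -
  obtain n :: nat where n: "r \<le> real n" using real_arch_simple by blast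
  define k where "k = Suc (Suc n)"
  have k: "0 < k" "k \<noteq> 1" "r \<le> 2 * real k" using n by (simp_all add: k_def)
  obtain D where D: "0 \<le> D"
    "\<And>u t. 0 < u \<Longrightarrow> 0 \<le> t \<Longrightarrow> t \<le> 1 \<Longrightarrow> sine_moment k u t \<le> D * t * (u ^ (2 * k) + u powr r)"
    using sine_moment_le[OF k(1) _ k(3) mom] q by auto
  have "((\<lambda>t. ennreal (1 / t) * abs_moment M (X t) q) \<longlongrightarrow> abs_moment \<nu> (\<lambda>x. x) q) (at_right 0)"
  proof (rule tendsto_abs_moment[where k = k and r = r and p = p and C = "max (2 * D) C"], goal_cases)
    case 1 show ?case by unfold_locales
  next
    case (2 t) then show ?case by (simp add: X_measurable)
  next
    case 3 show ?case by (rule sigma_finite_levy)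
  next
    case 4 show ?case by (simp add: borel_measurable_levy)
  next
    case 6 show ?case using q k by simp
  next
    case (9 t u)
    have "sine_moment k u t \<le> D * t * (u ^ (2 * k) + u powr r)" using 9 D by auto
    also have "\<dots> \<le> D * t * (2 * u powr r)"
      using 9 D power_le_powr[of u "2 * k" r] k by (intro mult_left_mono) auto
    finally have "1 / t * sine_moment k u t \<le> 1 / t * (D * t * (2 * u powr r))"
      using 9 by (intro mult_left_mono) auto
    also have "\<dots> = 2 * D * u powr r" using 9 by simp
    also have "\<dots> \<le> max (2 * D) C * u powr r" by (intro mult_right_mono) auto
    finally show ?case using 9 nn_integral_sine_power[of t k u]
      by (simp flip: ennreal_mult' add: ennreal_leI)
  next
    case (10 t u)
    have "1 / t * sine_moment k u t \<le> 1 / t * (t * cmod (\<Psi> u))"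
      using 10 k by (intro mult_left_mono sine_moment_le_exponent) auto
    also have "\<dots> = cmod (\<Psi> u)" using 10 by simp
    also have "\<dots> \<le> C * u powr p" using growth 10 by simp
    also have "\<dots> \<le> max (2 * D) C * u powr p" by (intro mult_right_mono) auto
    finally show ?case using 10 nn_integral_sine_power[of t k u]
      by (simp flip: ennreal_mult' add: ennreal_leI)
  next
    case (11 u)
    have "((\<lambda>t. ennreal (sine_moment k u t / t)) \<longlongrightarrow> ennreal (LINT y|\<nu>. sine_power k u y)) (at_right 0)"
      using sine_moment_div_tendsto[OF k(1), of u] k by (intro tendsto_ennrealI) simp
    moreover have "\<forall>\<^sub>F t in at_right 0. ennreal (sine_moment k u t / t) =
        ennreal (1 / t) * (\<integral>\<^sup>+\<omega>. ennreal (sine_power k u (X t \<omega>)) \<partial>M)"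
      unfolding eventually_at_right_field
    proof (intro exI[of _ 1] conjI allI impI)
      fix t :: real assume t: "0 < t"
      then have "(\<integral>\<^sup>+\<omega>. ennreal (sine_power k u (X t \<omega>)) \<partial>M) = ennreal (sine_moment k u t)"
        using nn_integral_sine_power[of t k u] by simp
      then show "ennreal (sine_moment k u t / t) =
        ennreal (1 / t) * (\<integral>\<^sup>+\<omega>. ennreal (sine_power k u (X t \<omega>)) \<partial>M)"
        using t by (simp flip: ennreal_mult')
    qed simp
    moreover have "ennreal (LINT y|\<nu>. sine_power k u y) = (\<integral>\<^sup>+y. ennreal (sine_power k u y) \<partial>\<nu>)"
      using nn_integral_eq_integral[OF integrable_sine_power[OF k(1), of u]] by (simp add: sine_power_bounds)
    ultimately show ?case by (auto intro: Lim_transform_eventually)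
  qed (use q in auto)
  then show ?thesis by (simp add: abs_moment_def)
qed

end

section \<open>Moments of rescaled marginals\<close>

lemma real_distribution_return: "real_distribution (return borel c)"
  by (simp add: real_distribution_def real_distribution_axioms_def prob_space_return)

lemma char_return: "char (return borel c) u = iexp (u * c)"
  unfolding char_def by (subst integral_return) auto

lemma distr_std_normal_scale:
  assumes "0 < \<sigma>"
  shows "distr std_normal_distribution borel (\<lambda>x. \<sigma> * x) = density lborel (\<lambda>x. ennreal (normal_density 0 \<sigma> x))"
proof -
  interpret prob_space std_normal_distribution by (rule prob_space_normal_density) simp
  have "distributed std_normal_distribution lborel (\<lambda>x. x) std_normal_density"
    by (simp add: distributed_def) (metis distr_id2 sets_density sets_lborel)
  from normal_density_affine[OF this, of \<sigma> 0] assms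
  have "distributed std_normal_distribution lborel (\<lambda>x. \<sigma> * x) (normal_density 0 \<sigma>)" by simp
  then have "distr std_normal_distribution lborel (\<lambda>x. \<sigma> * x) = density lborel (\<lambda>x. ennreal (normal_density 0 \<sigma> x))"
    by (simp add: distributed_def)
  moreover have "distr std_normal_distribution borel (\<lambda>x. \<sigma> * x) = distr std_normal_distribution lborel (\<lambda>x. \<sigma> * x)"
    by (rule distr_cong) auto
  ultimately show ?thesis by simp
qed

lemma real_distribution_normal:
  "0 < \<sigma> \<Longrightarrow> real_distribution (density lborel (\<lambda>x. ennreal (normal_density 0 \<sigma> x)))"
  by (simp add: real_distribution_def real_distribution_axioms_def prob_space_normal_density)

lemma char_normal:
  assumes "0 < \<sigma>"
  shows "char (density lborel (\<lambda>x. ennreal (normal_density 0 \<sigma> x))) u = of_real (exp (- (\<sigma>\<^sup>2 * u\<^sup>2) / 2))"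
proof -
  have "char (density lborel (\<lambda>x. ennreal (normal_density 0 \<sigma> x))) u = (CLINT x|std_normal_distribution. iexp (u * (\<sigma> * x)))"
    unfolding distr_std_normal_scale[OF assms, symmetric] char_def by (subst integral_distr) auto
  also have "\<dots> = char std_normal_distribution (u * \<sigma>)" by (simp add: char_def mult.assoc)
  also have "\<dots> = of_real (exp (- (\<sigma>\<^sup>2 * u\<^sup>2) / 2))"
    by (simp add: char_std_normal_distribution power_mult_distrib mult.commute)
  finally show ?thesis .
qed

context levy_marginals begin

text \<open>Convergence of characteristic functions together with the domination near 0 yields convergence of
  moments of order \<open>q < 2\<close>. Away from 0 the trivial bound \<open>sine_moment \<le> 1\<close> is enough, because
  \<open>u powr (-1-q)\<close> is integrable there.\<close>

lemma scaled_moment_tendsto: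
  assumes q: "0 < q" "q < 2" "q < r"
    and a: "\<And>t. 0 < t \<Longrightarrow> 0 < a t"
    and \<mu>: "real_distribution \<mu>"
    and lim: "\<And>v. 0 < v \<Longrightarrow> ((\<lambda>t. exp (of_real t * \<Psi> (v / a t))) \<longlongrightarrow> char \<mu> v) (at_right 0)"
    and bound: "\<And>t v. 0 < t \<Longrightarrow> t < 1 \<Longrightarrow> 0 < v \<Longrightarrow> v < 1 \<Longrightarrow> sine_moment 1 (v / a t) t \<le> C * v powr r"
  shows "((\<lambda>t. ennreal (a t powr (-q)) * abs_moment M (X t) q) \<longlongrightarrow> abs_moment \<mu> (\<lambda>x. x) q) (at_right 0)"
proof -
  interpret \<mu>: real_distribution \<mu> by fact
  have nn: "(\<integral>\<^sup>+\<omega>. ennreal (sine_power 1 v (X t \<omega> / a t)) \<partial>M) = ennreal (sine_moment 1 (v / a t) t)"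
    if "0 < t" for t v
    using nn_integral_sine_power[of t 1 "v / a t"] that by (simp add: sine_power_def)
  have "((\<lambda>t. 1 * abs_moment M (\<lambda>\<omega>. X t \<omega> / a t) q) \<longlongrightarrow> abs_moment \<mu> (\<lambda>x. x) q) (at_right 0)"
  proof (rule tendsto_abs_moment[where k = 1 and r = r and p = 0 and C = "max C 1"], goal_cases)
    case 1 show ?case by unfold_locales
  next
    case (2 t) then show ?case using X_measurable[of t] by simp
  next
    case 3 show ?case by unfold_locales
  next
    case (9 t u)
    have "sine_moment 1 (u / a t) t \<le> C * u powr r" using bound 9 by simp
    also have "\<dots> \<le> max C 1 * u powr r" by (intro mult_right_mono) auto
    finally show ?case unfolding nn[OF 9(1)] by (simp add: ennreal_leI)
  next
    case (10 t u)
    have "sine_moment 1 (u / a t) t \<le> expectation (\<lambda>\<omega>. 1)"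
      unfolding sine_moment_def using 10
      by (intro integral_mono integrable_sine_moment) (auto simp: sine_power_bounds)
    then have "sine_moment 1 (u / a t) t \<le> max C 1 * u powr 0" using 10 by (simp add: prob_space)
    then show ?case unfolding nn[OF 10(1)] mult_1 by (rule ennreal_leI)
  next
    case (11 u)
    have "((\<lambda>t. ennreal ((1 - Re (exp (of_real t * \<Psi> (u / a t)))) / 2)) \<longlongrightarrow> ennreal ((1 - Re (char \<mu> u)) / 2)) (at_right 0)"
      by (intro tendsto_intros lim 11) simp
    moreover have "\<forall>\<^sub>F t in at_right 0. ennreal ((1 - Re (exp (of_real t * \<Psi> (u / a t)))) / 2) =
        1 * (\<integral>\<^sup>+\<omega>. ennreal (sine_power 1 u (X t \<omega> / a t)) \<partial>M)"
      unfolding eventually_at_right_field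
    proof (intro exI[of _ 1] conjI allI impI)
      fix t :: real assume t: "0 < t"
      show "ennreal ((1 - Re (exp (of_real t * \<Psi> (u / a t)))) / 2) =
        1 * (\<integral>\<^sup>+\<omega>. ennreal (sine_power 1 u (X t \<omega> / a t)) \<partial>M)"
        unfolding nn[OF t] using t by (subst sine_moment_1) simp_all
    qed simp
    moreover have "(\<integral>\<^sup>+x. ennreal (sine_power 1 u x) \<partial>\<mu>) = ennreal ((1 - Re (char \<mu> u)) / 2)"
    proof -
      have "integrable \<mu> (sine_power 1 u)"
        by (rule \<mu>.integrable_const_bound[of _ 1]) (auto simp: sine_power_bounds)
      from nn_integral_eq_integral[OF this]
      have "(\<integral>\<^sup>+x. ennreal (sine_power 1 u x) \<partial>\<mu>) = ennreal (LINT x|\<mu>. sine_power 1 u x)"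
        by (simp add: sine_power_bounds)
      also have "(LINT x|\<mu>. sine_power 1 u x) = (1 - Re (char \<mu> u)) / 2"
        unfolding char_def by (rule \<mu>.expectation_sine_power_1) simp
      finally show ?thesis .
    qed
    ultimately show ?case by (auto intro: Lim_transform_eventually)
  qed (use q in auto)
  moreover have "\<forall>\<^sub>F t in at_right 0. 1 * abs_moment M (\<lambda>\<omega>. X t \<omega> / a t) q =
      ennreal (a t powr (-q)) * abs_moment M (X t) q"
    unfolding eventually_at_right_field
  proof (intro exI[of _ 1] conjI allI impI)
    fix t :: real assume t: "0 < t"
    note X_measurable[OF less_imp_le[OF t], measurable]
    have "ennreal (\<bar>X t \<omega> / a t\<bar> powr q) = ennreal (a t powr (-q)) * ennreal (\<bar>X t \<omega>\<bar> powr q)" for \<omega>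
      using a[OF t] by (simp add: powr_divide powr_minus_divide flip: ennreal_mult')
    then show "1 * abs_moment M (\<lambda>\<omega>. X t \<omega> / a t) q = ennreal (a t powr (-q)) * abs_moment M (X t) q"
      by (simp add: abs_moment_def nn_integral_cmult)
  qed simp
  ultimately show ?thesis by (rule Lim_transform_eventually)
qed

text \<open>With \<open>X t / t\<close> the exponent becomes \<open>t \<Psi> (v / t) = \<i> \<delta> v + O(v powr r t powr (1 - r))\<close>, where \<open>\<delta>\<close> is the drift,
  and \<open>r < 1\<close> lets the error vanish. The limit law is the point mass at \<open>\<delta>\<close>.\<close>

lemma moment_tendsto_drift:
  assumes \<sigma>: "\<sigma> = 0" and q: "0 < q" "q < r" "r < 1" and mom: "small_moment r" "large_moment r"
  shows "((\<lambda>t. ennreal (t powr (-q)) * abs_moment M (X t) q) \<longlongrightarrow>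
     ennreal (\<bar>levy_drift \<gamma> \<nu>\<bar> powr q)) (at_right 0)"
proof -
  define \<delta> where "\<delta> = levy_drift \<gamma> \<nu>"
  obtain C where C: "0 \<le> C" "\<And>u. 0 < u \<Longrightarrow> cmod (\<Psi> u - \<i> * of_real (\<delta> * u)) \<le> C * u powr r"
    using exponent_minus_drift_powr[of r] q mom \<sigma> unfolding \<delta>_def by auto
  have dev: "cmod (of_real t * \<Psi> (v / t) - \<i> * of_real (\<delta> * v)) \<le> C * v powr r * t powr (1 - r)"
    if t: "0 < t" and v: "0 < v" for t v
  proof -
    have "of_real t * \<Psi> (v / t) - \<i> * of_real (\<delta> * v) = of_real t * (\<Psi> (v / t) - \<i> * of_real (\<delta> * (v / t)))"
      using t by (simp add: field_simps)
    then have "cmod (of_real t * \<Psi> (v / t) - \<i> * of_real (\<delta> * v)) \<le> t * (C * (v / t) powr r)"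
      using t v C(2)[of "v / t"] by (simp add: norm_mult)
    also have "\<dots> = C * v powr r * t powr (1 - r)"
      using t v by (simp add: powr_divide powr_diff)
    finally show ?thesis .
  qed
  have "((\<lambda>t. ennreal (t powr (-q)) * abs_moment M (X t) q) \<longlongrightarrow> abs_moment (return borel \<delta>) (\<lambda>x. x) q) (at_right 0)"
  proof (rule scaled_moment_tendsto[OF _ _ q(2), where C = "\<bar>\<delta>\<bar> + C"])
    show "real_distribution (return borel \<delta>)" by (rule real_distribution_return)
    fix v :: real assume v: "0 < v"
    have "((\<lambda>t. of_real t * \<Psi> (v / t) - \<i> * of_real (\<delta> * v)) \<longlongrightarrow> 0) (at_right 0)"
    proof (rule Lim_null_comparison)
      show "\<forall>\<^sub>F t in at_right 0. cmod (of_real t * \<Psi> (v / t) - \<i> * of_real (\<delta> * v)) \<le> C * v powr r * t powr (1 - r)"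
        unfolding eventually_at_right_field by (intro exI[of _ 1]) (use dev v in auto)
      have "((\<lambda>t::real. t powr (1 - r)) \<longlongrightarrow> 0) (at_right 0)"
        using q by real_asymp
      then show "((\<lambda>t. C * v powr r * t powr (1 - r)) \<longlongrightarrow> 0) (at_right 0)"
        by (rule tendsto_mult_right_zero)
    qed
    then have "((\<lambda>t. exp (of_real t * \<Psi> (v / t))) \<longlongrightarrow> exp (\<i> * of_real (\<delta> * v))) (at_right 0)"
      by (intro tendsto_exp) (simp add: LIM_zero_iff)
    then show "((\<lambda>t. exp (of_real t * \<Psi> (v / t))) \<longlongrightarrow> char (return borel \<delta>) v) (at_right 0)"
      by (simp add: char_return mult.commute)
  next
    fix t v :: real assume tv: "0 < t" "t < 1" "0 < v" "v < 1"
    have "sine_moment 1 (v / t) t \<le> t * cmod (\<Psi> (v / t))"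
      using tv by (intro sine_moment_le_exponent) auto
    also have "\<dots> = cmod (of_real t * \<Psi> (v / t))" using tv by (simp add: norm_mult)
    also have "\<dots> \<le> cmod (of_real t * \<Psi> (v / t) - \<i> * of_real (\<delta> * v)) + cmod (\<i> * of_real (\<delta> * v))"
      using norm_triangle_ineq[of "of_real t * \<Psi> (v / t) - \<i> * of_real (\<delta> * v)" "\<i> * of_real (\<delta> * v)"] by simp
    also have "\<dots> \<le> C * v powr r * 1 + \<bar>\<delta>\<bar> * v powr r"
    proof (rule add_mono)
      have "t powr (1 - r) \<le> 1" using tv q by (intro powr_le1) auto
      then show "cmod (of_real t * \<Psi> (v / t) - \<i> * of_real (\<delta> * v)) \<le> C * v powr r * 1"
        using order_trans[OF dev[of t v] mult_left_mono[of "t powr (1 - r)" 1 "C * v powr r"]] tv C(1) by simp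
      show "cmod (\<i> * of_real (\<delta> * v)) \<le> \<bar>\<delta>\<bar> * v powr r"
        using power_le_powr[of v 1 r] tv q by (simp add: norm_mult abs_mult mult_left_mono)
    qed
    finally show "sine_moment 1 (v / t) t \<le> (\<bar>\<delta>\<bar> + C) * v powr r" by (simp add: algebra_simps)
  qed (use q in auto)
  also have "abs_moment (return borel \<delta>) (\<lambda>x. x) q = ennreal (\<bar>\<delta>\<bar> powr q)"
    unfolding abs_moment_def by (subst nn_integral_return) auto
  finally show ?thesis by (simp add: \<delta>_def)
qed

text \<open>With \<open>X t / sqrt t\<close> the exponent is \<open>t \<Psi> (v / sqrt t) = v\<^sup>2 (\<Psi> w / w\<^sup>2)\<close> for \<open>w = v / sqrt t \<rightarrow> \<infinity>\<close>, which tends to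
  \<open>- \<sigma>\<^sup>2 v\<^sup>2 / 2\<close>. The uniform estimate of the sine moments gives \<open>C (v\<^sup>2 + t powr (1 - r / 2) v powr r)\<close>, and
  \<open>r \<le> 2\<close> keeps this bounded by a multiple of \<open>v powr r\<close>.\<close>

lemma moment_tendsto_gaussian:
  assumes \<sigma>: "0 < \<sigma>" and q: "0 < q" "q < r" "r \<le> 2" and mom: "large_moment r"
  shows "((\<lambda>t. ennreal (t powr (-(q/2))) * abs_moment M (X t) q) \<longlongrightarrow> normal_abs_moment \<sigma> q) (at_right 0)"
proof -
  obtain C where C: "0 \<le> C"
    "\<And>u t. 0 < u \<Longrightarrow> 0 \<le> t \<Longrightarrow> t \<le> 1 \<Longrightarrow> sine_moment 1 u t \<le> C * t * (u ^ (2 * 1) + u powr r)"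
    using sine_moment_le[of 1 r] q mom by auto
  let ?N = "density lborel (\<lambda>x. ennreal (normal_density 0 \<sigma> x))"
  have "((\<lambda>t. ennreal (sqrt t powr (-q)) * abs_moment M (X t) q) \<longlongrightarrow> abs_moment ?N (\<lambda>x. x) q) (at_right 0)"
  proof (rule scaled_moment_tendsto[OF _ _ q(2), where C = "2 * C"])
    show "real_distribution ?N" by (rule real_distribution_normal[OF \<sigma>])
    fix v :: real assume v: "0 < v"
    have "filterlim (\<lambda>t. v / sqrt t) at_top (at_right 0)" using v by real_asymp
    from filterlim_compose[OF exponent_over_square_tendsto this]
    have "((\<lambda>t. of_real (v\<^sup>2) * (\<Psi> (v / sqrt t) / of_real ((v / sqrt t)\<^sup>2))) \<longlongrightarrow>
        of_real (v\<^sup>2) * - of_real (\<sigma>\<^sup>2 / 2)) (at_right 0)"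
      by (rule tendsto_mult_left)
    moreover have "\<forall>\<^sub>F t in at_right 0. of_real (v\<^sup>2) * (\<Psi> (v / sqrt t) / of_real ((v / sqrt t)\<^sup>2)) =
        of_real t * \<Psi> (v / sqrt t)"
      unfolding eventually_at_right_field
    proof (intro exI[of _ 1] conjI allI impI)
      fix t :: real assume t: "0 < t"
      have "v\<^sup>2 / (v / sqrt t)\<^sup>2 = t" using t v by (simp add: power_divide)
      then have "of_real (v\<^sup>2) / complex_of_real ((v / sqrt t)\<^sup>2) = of_real t" by (simp only: flip: of_real_divide)
      then show "of_real (v\<^sup>2) * (\<Psi> (v / sqrt t) / of_real ((v / sqrt t)\<^sup>2)) = of_real t * \<Psi> (v / sqrt t)"
        by (metis times_divide_eq_left times_divide_eq_right)
    qed simp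
    ultimately have "((\<lambda>t. of_real t * \<Psi> (v / sqrt t)) \<longlongrightarrow> of_real (v\<^sup>2) * - of_real (\<sigma>\<^sup>2 / 2)) (at_right 0)"
      by (rule Lim_transform_eventually)
    then have "((\<lambda>t. exp (of_real t * \<Psi> (v / sqrt t))) \<longlongrightarrow> exp (of_real (v\<^sup>2) * - of_real (\<sigma>\<^sup>2 / 2))) (at_right 0)"
      by (rule tendsto_exp)
    also have "exp (of_real (v\<^sup>2) * - of_real (\<sigma>\<^sup>2 / 2)) = char ?N v"
      unfolding char_normal[OF \<sigma>] by (simp add: mult.commute flip: exp_of_real)
    finally show "((\<lambda>t. exp (of_real t * \<Psi> (v / sqrt t))) \<longlongrightarrow> char ?N v) (at_right 0)" .
  next
    fix t v :: real assume tv: "0 < t" "t < 1" "0 < v" "v < 1"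
    have r: "0 < r" using q by simp
    have "sine_moment 1 (v / sqrt t) t \<le> C * (t * ((v / sqrt t) ^ (2 * 1) + (v / sqrt t) powr r))"
      using C(2)[of "v / sqrt t" t] tv by (simp add: mult.assoc)
    also have "\<dots> \<le> C * (v powr r + v powr r)"
    proof (rule mult_left_mono[OF _ C(1)])
      have "t * (v / sqrt t) ^ (2 * 1) = v ^ 2" using tv by (simp add: power_divide)
      also have "\<dots> \<le> v powr r" using tv q by (intro power_le_powr) auto
      finally have 1: "t * (v / sqrt t) ^ (2 * 1) \<le> v powr r" .
      have "t * (v / sqrt t) powr r = t powr (1 - r / 2) * v powr r"
        using tv by (simp add: powr_divide powr_diff powr_half_sqrt[symmetric] powr_powr)
      also have "\<dots> \<le> 1 * v powr r"
        using tv q by (intro mult_right_mono powr_le1) auto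
      finally show "t * ((v / sqrt t) ^ (2 * 1) + (v / sqrt t) powr r) \<le> v powr r + v powr r"
        using 1 by (simp add: distrib_left)
    qed
    finally show "sine_moment 1 (v / sqrt t) t \<le> 2 * C * v powr r" by simp
  qed (use q in auto)
  moreover have "\<forall>\<^sub>F t in at_right 0. ennreal (sqrt t powr (-q)) * abs_moment M (X t) q =
      ennreal (t powr (-(q/2))) * abs_moment M (X t) q"
    unfolding eventually_at_right_field
    by (intro exI[of _ 1]) (auto simp: powr_half_sqrt[symmetric] powr_powr)
  ultimately show ?thesis unfolding normal_abs_moment_def by (rule Lim_transform_eventually)
qed

end

section \<open>The second moment\<close>

context levy_marginals begin

text \<open>The functions \<open>4 sin (u x / 2) ^ 2 / u\<^sup>2\<close> tend to \<open>x\<^sup>2\<close> as \<open>u\<close> tends to 0. Their expectations are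
  \<open>2 (1 - Re (exp (t \<Psi> u))) / u\<^sup>2\<close> and are bounded with \<open>- Re (\<Psi> u) \<le> u\<^sup>2 V / 2\<close>, where \<open>V\<close> is the variance per unit time,
  and \<open>\<bar>Im (\<Psi> u)\<bar> \<le> u D\<close>. Fatou's lemma transfers the bound to \<open>x\<^sup>2\<close>.\<close>

lemma second_moment_le:
  assumes mom: "large_moment 2"
  obtains D where "0 \<le> D"
    "\<And>t. 0 < t \<Longrightarrow> abs_moment M (X t) 2 \<le> ennreal (t * (\<sigma>\<^sup>2 + (LINT x|\<nu>. x\<^sup>2)) + t\<^sup>2 * D)"
proof
  define V where "V = \<sigma>\<^sup>2 + (LINT x|\<nu>. x\<^sup>2)"
  define D where "D = \<bar>\<gamma>\<bar> + (LINT x|\<nu>. x\<^sup>2)"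
  have int: "integrable \<nu> (\<lambda>x. x\<^sup>2)"
    using integrable_powr[OF small_moment_2 mom] by simp
  show "0 \<le> D\<^sup>2" by simp
  have Re: "- Re (\<Psi> u) \<le> u\<^sup>2 / 2 * V" for u
  proof -
    have "(LINT x|\<nu>. 1 - cos (u * x)) \<le> (LINT x|\<nu>. u\<^sup>2 / 2 * x\<^sup>2)"
    proof (rule integral_mono')
      fix x
      have "1 - cos (u * x) = 1 - Re (exp (\<i> * of_real (u * x)))" by (simp add: Re_exp)
      also have "\<dots> \<le> - Re (\<i> * of_real (u * x)) + (Im (\<i> * of_real (u * x)))\<^sup>2 / 2"
        by (rule one_minus_Re_exp_le_square) simp
      also have "\<dots> = u\<^sup>2 / 2 * x\<^sup>2" by (simp add: power_mult_distrib)
      finally show "1 - cos (u * x) \<le> u\<^sup>2 / 2 * x\<^sup>2" .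
    qed (use int in auto)
    then show ?thesis by (simp add: Re_exponent V_def algebra_simps)
  qed
  have Im: "\<bar>Im (\<Psi> u)\<bar> \<le> u * D" if u: "0 < u" "u \<le> 1" for u
  proof -
    have "\<bar>LINT x|\<nu>. sin (u * x) - u * x * indicator {x. \<bar>x\<bar> \<le> 1} x\<bar> \<le> (LINT x|\<nu>. u * x\<^sup>2)"
    proof (rule order_trans[OF integral_abs_bound integral_mono'])
      fix x
      have "\<bar>sin (u * x) - u * x\<bar> \<le> u * x\<^sup>2"
      proof -
        have "\<bar>sin (u * x) - u * x\<bar> = \<bar>Im (iexp (u * x) - (\<Sum>k\<le>1. (\<i> * of_real (u * x)) ^ k / fact k))\<bar>"
          by (simp add: Im_exp)
        also have "\<dots> \<le> (u * x)\<^sup>2 / 2"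
          using order_trans[OF abs_Im_le_cmod iexp_approx1[of "u * x" 1]] by (simp add: power2_eq_square)
        also have "\<dots> \<le> u * (u * x\<^sup>2)" using u by (simp add: power2_eq_square)
        also have "\<dots> \<le> 1 * (u * x\<^sup>2)" using u by (intro mult_right_mono) auto
        finally show ?thesis by simp
      qed
      moreover have "\<bar>sin (u * x)\<bar> \<le> u * x\<^sup>2" if "1 < \<bar>x\<bar>"
      proof -
        have "\<bar>sin (u * x)\<bar> \<le> u * (\<bar>x\<bar> * 1)" using abs_sin_x_le_abs_x[of "u * x"] u by (simp add: abs_mult)
        also have "\<dots> \<le> u * (\<bar>x\<bar> * \<bar>x\<bar>)" using that u by (intro mult_left_mono) auto
        finally show ?thesis by (simp add: power2_eq_square)
      qed
      ultimately show "\<bar>sin (u * x) - u * x * indicator {x. \<bar>x\<bar> \<le> 1} x\<bar> \<le> u * x\<^sup>2"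
        by (cases "\<bar>x\<bar> \<le> 1") auto
    qed (use int u in auto)
    moreover have "\<bar>\<gamma> * u\<bar> = u * \<bar>\<gamma>\<bar>" using u by (simp add: abs_mult)
    ultimately show ?thesis unfolding Im_exponent D_def by (simp add: algebra_simps)
  qed
  fix t :: real assume t: "0 < t"
  note X_measurable[OF less_imp_le[OF t], measurable]
  have step: "4 / u\<^sup>2 * sine_moment 1 u t \<le> t * V + t\<^sup>2 * D\<^sup>2" if u: "0 < u" "u \<le> 1" for u
  proof -
    have "1 - Re (exp (of_real t * \<Psi> u)) \<le> - Re (of_real t * \<Psi> u) + (Im (of_real t * \<Psi> u))\<^sup>2 / 2"
      using Re_exponent_le_0[of u] t by (intro one_minus_Re_exp_le_square) (simp add: mult_nonneg_nonpos)
    also have "\<dots> = t * (- Re (\<Psi> u)) + t\<^sup>2 * \<bar>Im (\<Psi> u)\<bar>\<^sup>2 / 2" by (simp add: power_mult_distrib)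
    also have "\<dots> \<le> t * (u\<^sup>2 / 2 * V) + t\<^sup>2 * (u * D)\<^sup>2 / 2"
      using t by (intro add_mono mult_left_mono Re divide_right_mono power_mono Im u) auto
    finally have "sine_moment 1 u t \<le> u\<^sup>2 / 4 * (t * V + t\<^sup>2 * D\<^sup>2)"
      using sine_moment_1[of t u] t by (simp add: power_mult_distrib field_simps)
    then have "4 / u\<^sup>2 * sine_moment 1 u t \<le> 4 / u\<^sup>2 * (u\<^sup>2 / 4 * (t * V + t\<^sup>2 * D\<^sup>2))"
      by (rule mult_left_mono) simp
    then show ?thesis using u by simp
  qed
  \<comment> \<open>Fatou's lemma is used along this sequence of values of \<open>u\<close>.\<close>
  define w where "w n = 1 / real (Suc n)" for n
  have w: "0 < w n" "w n \<le> 1" for n by (simp_all add: w_def)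
  have w0: "filterlim w (at_right 0) sequentially"
    unfolding w_def by real_asymp
  from filterlim_compose[OF sine_power_1_tendsto w0]
  have "(\<lambda>n. ennreal (4 / (w n)\<^sup>2 * sine_power 1 (w n) x)) \<longlonglongrightarrow> ennreal (x\<^sup>2)" for x
    by (rule tendsto_ennrealI)
  then have L: "liminf (\<lambda>n. ennreal (4 / (w n)\<^sup>2 * sine_power 1 (w n) x)) = ennreal (x\<^sup>2)" for x
    by (intro lim_imp_Liminf) auto
  have "abs_moment M (X t) 2 = (\<integral>\<^sup>+\<omega>. liminf (\<lambda>n. ennreal (4 / (w n)\<^sup>2 * sine_power 1 (w n) (X t \<omega>))) \<partial>M)"
    unfolding abs_moment_def L by simp
  also have "\<dots> \<le> liminf (\<lambda>n. (\<integral>\<^sup>+\<omega>. ennreal (4 / (w n)\<^sup>2 * sine_power 1 (w n) (X t \<omega>)) \<partial>M))"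
    by (rule nn_integral_liminf) measurable
  also have "\<dots> \<le> liminf (\<lambda>n. ennreal (t * V + t\<^sup>2 * D\<^sup>2))"
  proof (intro Liminf_mono always_eventually allI)
    fix n
    have "(\<integral>\<^sup>+\<omega>. ennreal (4 / (w n)\<^sup>2 * sine_power 1 (w n) (X t \<omega>)) \<partial>M) =
        ennreal (4 / (w n)\<^sup>2) * ennreal (sine_moment 1 (w n) t)"
      using t by (simp only: ennreal_mult' divide_nonneg_nonneg zero_le_power2 zero_le_numeral)
         (subst nn_integral_cmult, simp, simp add: nn_integral_sine_power)
    then show "(\<integral>\<^sup>+\<omega>. ennreal (4 / (w n)\<^sup>2 * sine_power 1 (w n) (X t \<omega>)) \<partial>M) \<le> ennreal (t * V + t\<^sup>2 * D\<^sup>2)"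
      using step[OF w] by (simp flip: ennreal_mult' add: ennreal_leI)
  qed
  also have "\<dots> = ennreal (t * V + t\<^sup>2 * D\<^sup>2)" by (simp add: Liminf_const)
  finally show "abs_moment M (X t) 2 \<le> ennreal (t * (\<sigma>\<^sup>2 + (LINT x|\<nu>. x\<^sup>2)) + t\<^sup>2 * D\<^sup>2)"
    by (simp add: V_def)
qed

text \<open>The upper bound is the previous lemma. For the lower bound, \<open>x\<^sup>2 \<ge> 4 sin (u x / 2) ^ 2 / u\<^sup>2\<close> for each fixed \<open>u\<close>,
  the expectation of the right-hand side divided by \<open>t\<close> has a limit \<open>L u\<close> as \<open>t\<close> tends to 0, and \<open>L u\<close> tends to the
  claimed limit as \<open>u\<close> tends to 0.\<close>

lemma second_moment_div_tendsto:
  assumes mom: "large_moment 2"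
  shows "((\<lambda>t. ennreal (1 / t) * abs_moment M (X t) 2) \<longlongrightarrow>
     ennreal (\<sigma>\<^sup>2) + (\<integral>\<^sup>+x. ennreal (\<bar>x\<bar> powr 2) \<partial>\<nu>)) (at_right 0)"
proof -
  define V where "V = \<sigma>\<^sup>2 + (LINT x|\<nu>. x\<^sup>2)"
  have int: "integrable \<nu> (\<lambda>x. x\<^sup>2)"
    using integrable_powr[OF small_moment_2 mom] by simp
  have V: "ennreal V = ennreal (\<sigma>\<^sup>2) + (\<integral>\<^sup>+x. ennreal (\<bar>x\<bar> powr 2) \<partial>\<nu>)"
    using nn_integral_eq_integral[OF int] by (simp add: V_def)
  obtain D where D: "0 \<le> D" "\<And>t. 0 < t \<Longrightarrow> abs_moment M (X t) 2 \<le> ennreal (t * V + t\<^sup>2 * D)"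
    using second_moment_le[OF mom] unfolding V_def by blast
  define L where "L u = \<sigma>\<^sup>2 + (LINT x|\<nu>. 4 / u\<^sup>2 * sine_power 1 u x)" for u
  have sq: "4 / u\<^sup>2 * sine_power 1 u x \<le> x\<^sup>2" if "0 < u" for u x
  proof -
    have "sine_power 1 u x \<le> (u * x / 2)\<^sup>2"
      unfolding sine_power_def using abs_sin_x_le_abs_x[of "u * x / 2"] by (simp add: abs_le_square_iff[symmetric])
    then have "4 / u\<^sup>2 * sine_power 1 u x \<le> 4 / u\<^sup>2 * (u * x / 2)\<^sup>2" by (rule mult_left_mono) simp
    then show ?thesis using that by (simp add: power_mult_distrib power_divide)
  qed
  have L: "(L \<longlongrightarrow> V) (at_right 0)"
    unfolding L_def V_def
  proof (intro tendsto_add tendsto_const tendsto_at_right_sequentially[of 0 1])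
    fix S :: "nat \<Rightarrow> real" assume S: "\<And>n. 0 < S n" "S \<longlonglongrightarrow> 0"
    have S0: "filterlim S (at_right 0) sequentially"
      using S by (auto simp: filterlim_at less_imp_neq[symmetric] intro!: always_eventually)
    show "(\<lambda>n. LINT x|\<nu>. 4 / (S n)\<^sup>2 * sine_power 1 (S n) x) \<longlonglongrightarrow> (LINT x|\<nu>. x\<^sup>2)"
    proof (rule integral_dominated_convergence[where w = "\<lambda>x. x\<^sup>2"])
      from filterlim_compose[OF sine_power_1_tendsto S0]
      show "AE x in \<nu>. (\<lambda>n. 4 / (S n)\<^sup>2 * sine_power 1 (S n) x) \<longlonglongrightarrow> x\<^sup>2" by simp
      show "AE x in \<nu>. norm (4 / (S n)\<^sup>2 * sine_power 1 (S n) x) \<le> x\<^sup>2" for n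
        using sq[OF S(1)] by (simp add: sine_power_bounds)
    qed (use int in \<open>auto simp: borel_measurable_levy\<close>)
  qed simp
  have lower: "ennreal (4 / u\<^sup>2 * (sine_moment 1 u t / t)) \<le> ennreal (1 / t) * abs_moment M (X t) 2"
    if "0 < u" "0 < t" for u t
  proof -
    note X_measurable[OF less_imp_le[OF that(2)], measurable]
    have "ennreal (4 / u\<^sup>2 * (sine_moment 1 u t / t)) = ennreal (1 / t) * (ennreal (4 / u\<^sup>2) * ennreal (sine_moment 1 u t))"
      using that ennreal_mult'[of "1 / t" "4 / u\<^sup>2 * sine_moment 1 u t"] ennreal_mult'[of "4 / u\<^sup>2" "sine_moment 1 u t"]
      by (simp only: zero_le_divide_1_iff less_imp_le divide_nonneg_nonneg zero_le_numeral zero_le_power2 mult_ac)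
        (simp add: mult_ac)
    also have "ennreal (4 / u\<^sup>2) * ennreal (sine_moment 1 u t) =
        (\<integral>\<^sup>+\<omega>. ennreal (4 / u\<^sup>2) * ennreal (sine_power 1 u (X t \<omega>)) \<partial>M)"
      using that by (subst nn_integral_cmult) (auto simp: nn_integral_sine_power)
    also have "\<dots> \<le> abs_moment M (X t) 2"
      unfolding abs_moment_def
      using sq[OF that(1)] by (intro nn_integral_mono) (simp add: ennreal_leI flip: ennreal_mult')
    finally show ?thesis by (simp add: mult_left_mono)
  qed
  have "((\<lambda>t. ennreal (1 / t) * abs_moment M (X t) 2) \<longlongrightarrow> ennreal V) (at_right 0)"
  proof (rule order_tendstoI)
    fix a assume "a < ennreal V"
    then have "\<forall>\<^sub>F u in at_right 0. a < ennreal (L u)"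
      by (rule order_tendstoD(1)[OF tendsto_ennrealI[OF L]])
    then have "\<forall>\<^sub>F u in at_right 0. 0 < u \<and> a < ennreal (L u)"
      using eventually_at_right_less[of "0::real"] by eventually_elim simp
    then obtain u where u: "0 < u" "a < ennreal (L u)"
      using eventually_happens'[of "at_right (0::real)"] by auto
    have "((\<lambda>t. 4 / u\<^sup>2 * (sine_moment 1 u t / t)) \<longlongrightarrow> 4 / u\<^sup>2 * (\<sigma>\<^sup>2 * u\<^sup>2 / 4 + (LINT y|\<nu>. sine_power 1 u y))) (at_right 0)"
      using sine_moment_div_tendsto[of 1 u] by (intro tendsto_mult_left) simp
    also have "4 / u\<^sup>2 * (\<sigma>\<^sup>2 * u\<^sup>2 / 4 + (LINT y|\<nu>. sine_power 1 u y)) = L u"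
      using u by (simp add: L_def distrib_left)
    finally have "\<forall>\<^sub>F t in at_right 0. a < ennreal (4 / u\<^sup>2 * (sine_moment 1 u t / t))"
      by (rule order_tendstoD(1)[OF tendsto_ennrealI]) (rule u)
    then show "\<forall>\<^sub>F t in at_right 0. a < ennreal (1 / t) * abs_moment M (X t) 2"
      using eventually_at_right_less[of "0::real"]
      by eventually_elim (use lower u in \<open>auto intro: less_le_trans\<close>)
  next
    fix a assume a: "ennreal V < a"
    have "((\<lambda>t. V + t * D) \<longlongrightarrow> V + 0 * D) (at_right 0)"
      by (intro tendsto_intros)
    then have "\<forall>\<^sub>F t in at_right 0. ennreal (V + t * D) < a"
      using a by (intro order_tendstoD(2)[OF tendsto_ennrealI]) auto
    then show "\<forall>\<^sub>F t in at_right 0. ennreal (1 / t) * abs_moment M (X t) 2 < a"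
      using eventually_at_right_less[of "0::real"]
    proof eventually_elim
      case (elim t)
      have "ennreal (1 / t) * abs_moment M (X t) 2 \<le> ennreal (1 / t) * ennreal (t * V + t\<^sup>2 * D)"
        using D(2) elim by (intro mult_left_mono) auto
      also have "\<dots> = ennreal (1 / t * (t * V + t\<^sup>2 * D))"
        using elim by (intro ennreal_mult'[symmetric]) simp
      also have "1 / t * (t * V + t\<^sup>2 * D) = V + t * D"
        using elim by (simp add: distrib_left power2_eq_square)
      finally show ?case using elim by simp
    qed
  qed
  then show ?thesis by (simp only: V)
qed

end

section \<open>Marginals without jumps\<close>

lemma abs_moment_distr:
  assumes [measurable]: "Y \<in> borel_measurable M"
  shows "abs_moment (distr M borel Y) (\<lambda>x. x) q = abs_moment M Y q"
  unfolding abs_moment_def by (subst nn_integral_distr) auto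

context levy_marginals begin

lemma exponent_no_jumps:
  assumes "\<nu> = null_measure borel"
  shows "\<Psi> u = \<i> * of_real (\<gamma> * u) - of_real (\<sigma>\<^sup>2 / 2 * u\<^sup>2)"
  using assms by (simp add: levy_exponent_def)

lemma distr_X_eqI:
  assumes t: "0 \<le> t" and \<mu>: "real_distribution \<mu>" and c: "\<And>u. char \<mu> u = exp (of_real t * \<Psi> (a * u))"
  shows "distr M borel (\<lambda>\<omega>. a * X t \<omega>) = \<mu>"
proof (rule Levy_uniqueness)
  note X_measurable[OF t, measurable]
  show "real_distribution (distr M borel (\<lambda>\<omega>. a * X t \<omega>))" by simp
  show "char (distr M borel (\<lambda>\<omega>. a * X t \<omega>)) = char \<mu>"
  proof
    fix u
    have "char (distr M borel (\<lambda>\<omega>. a * X t \<omega>)) u = (CLINT \<omega>|M. iexp ((a * u) * X t \<omega>))"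
      unfolding char_def by (subst integral_distr) (auto simp: mult_ac)
    then show "char (distr M borel (\<lambda>\<omega>. a * X t \<omega>)) u = char \<mu> u" by (simp only: char_X[OF t] c)
  qed
qed (fact \<mu>)

lemma moment_deterministic:
  assumes "\<sigma> = 0" "\<nu> = null_measure borel" "0 \<le> t"
  shows "abs_moment M (X t) q = ennreal (\<bar>\<gamma> * t\<bar> powr q)"
proof -
  note X_measurable[OF assms(3), measurable]
  have "distr M borel (\<lambda>\<omega>. 1 * X t \<omega>) = return borel (\<gamma> * t)"
    by (rule distr_X_eqI[OF assms(3) real_distribution_return])
       (use assms exponent_no_jumps in \<open>simp add: char_return mult_ac\<close>)
  then have "abs_moment M (X t) q = abs_moment (return borel (\<gamma> * t)) (\<lambda>x. x) q"
    using abs_moment_distr[of "X t" M q] by simp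
  also have "\<dots> = ennreal (\<bar>\<gamma> * t\<bar> powr q)"
    unfolding abs_moment_def by (subst nn_integral_return) auto
  finally show ?thesis .
qed

lemma moment_tendsto_deterministic:
  assumes "\<sigma> = 0" "\<nu> = null_measure borel"
  shows "((\<lambda>t. ennreal (t powr (-q)) * abs_moment M (X t) q) \<longlongrightarrow> ennreal (\<bar>\<gamma>\<bar> powr q)) (at_right 0)"
proof (rule tendsto_eventually)
  show "\<forall>\<^sub>F t in at_right 0. ennreal (t powr (-q)) * abs_moment M (X t) q = ennreal (\<bar>\<gamma>\<bar> powr q)"
    using eventually_at_right_less[of "0::real"]
  proof eventually_elim
    case (elim t)
    have "t powr (-q) * \<bar>\<gamma> * t\<bar> powr q = \<bar>\<gamma>\<bar> powr q"
      using elim by (simp add: abs_mult powr_mult powr_minus_divide)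
    then show ?case using elim by (simp add: moment_deterministic[OF assms] flip: ennreal_mult')
  qed
qed

lemma normal_moment_dominated:
  assumes "0 < \<sigma>"
  shows "(\<integral>\<^sup>+x. ennreal ((\<bar>c\<bar> + \<bar>x\<bar>) ^ (2 * n)) \<partial>density lborel (\<lambda>x. ennreal (normal_density 0 \<sigma> x))) < \<infinity>"
proof -
  let ?N = "density lborel (\<lambda>x. ennreal (normal_density 0 \<sigma> x))"
  interpret N: prob_space ?N by (rule prob_space_normal_density[OF assms])
  have "integrable ?N (\<lambda>x. x ^ (2 * n))"
    using integrable_normal_moment[OF assms, of 0 "2 * n"] by (subst integrable_density) auto
  then have i: "integrable ?N (\<lambda>x. 2 ^ (2 * n) * (\<bar>c\<bar> ^ (2 * n) + \<bar>x\<bar> ^ (2 * n)))"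
    by (simp add: power_even_abs)
  have "(\<integral>\<^sup>+x. ennreal ((\<bar>c\<bar> + \<bar>x\<bar>) ^ (2 * n)) \<partial>?N) \<le>
      (\<integral>\<^sup>+x. ennreal (2 ^ (2 * n) * (\<bar>c\<bar> ^ (2 * n) + \<bar>x\<bar> ^ (2 * n))) \<partial>?N)"
    by (intro nn_integral_mono ennreal_leI power_add_le) auto
  also have "\<dots> < \<infinity>" using i by (subst nn_integral_eq_integral) (auto simp: less_top)
  finally show ?thesis .
qed

text \<open>Here \<open>X t / sqrt t\<close> has exactly the law \<open>N (\<gamma> sqrt t, \<sigma>\<^sup>2)\<close>, realised as a shift of the limit law, so
  dominated convergence applies to moments of every order.\<close>

lemma moment_tendsto_brownian:
  assumes \<sigma>: "0 < \<sigma>" and \<nu>: "\<nu> = null_measure borel" and q: "0 < q"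
  shows "((\<lambda>t. ennreal (t powr (-(q/2))) * abs_moment M (X t) q) \<longlongrightarrow> normal_abs_moment \<sigma> q) (at_right 0)"
proof -
  let ?N = "density lborel (\<lambda>x. ennreal (normal_density 0 \<sigma> x))"
  interpret N: real_distribution ?N by (rule real_distribution_normal[OF \<sigma>])
  obtain n :: nat where n: "q \<le> real n" using real_arch_simple by blast
  have eq: "ennreal (t powr (-(q/2))) * abs_moment M (X t) q = abs_moment ?N (\<lambda>x. \<gamma> * sqrt t + x) q"
    if t: "0 < t" for t
  proof -
    note X_measurable[OF less_imp_le[OF t], measurable]
    have "distr M borel (\<lambda>\<omega>. (1 / sqrt t) * X t \<omega>) = distr ?N borel (\<lambda>x. \<gamma> * sqrt t + x)"
    proof (rule distr_X_eqI)
      fix u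
      have "char (distr ?N borel (\<lambda>x. \<gamma> * sqrt t + x)) u = (CLINT x|?N. iexp (u * (\<gamma> * sqrt t)) * iexp (u * x))"
        unfolding char_def by (subst integral_distr) (auto simp: distrib_left exp_add)
      also have "\<dots> = iexp (u * (\<gamma> * sqrt t)) * char ?N u" unfolding char_def by simp
      also have "\<dots> = exp (\<i> * of_real (u * (\<gamma> * sqrt t)) + of_real (- (\<sigma>\<^sup>2 * u\<^sup>2) / 2))"
        unfolding char_normal[OF \<sigma>] exp_add exp_of_real ..
      also have "\<i> * of_real (u * (\<gamma> * sqrt t)) + of_real (- (\<sigma>\<^sup>2 * u\<^sup>2) / 2) = of_real t * \<Psi> (1 / sqrt t * u)"
      proof -
        have 1: "t * (\<gamma> * (1 / sqrt t * u)) = u * (\<gamma> * sqrt t)"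
          using t real_div_sqrt[of t] by (simp add: field_simps)
        have 2: "t * (\<sigma>\<^sup>2 / 2 * (1 / sqrt t * u)\<^sup>2) = \<sigma>\<^sup>2 * u\<^sup>2 / 2"
          using t by (simp add: power_mult_distrib power_divide)
        have "of_real t * \<Psi> (1 / sqrt t * u) =
            \<i> * of_real (t * (\<gamma> * (1 / sqrt t * u))) - of_real (t * (\<sigma>\<^sup>2 / 2 * (1 / sqrt t * u)\<^sup>2))"
          unfolding exponent_no_jumps[OF \<nu>] of_real_mult by (simp only: right_diff_distrib mult_ac)
        then show ?thesis unfolding 1 2 by simp
      qed
      finally show "char (distr ?N borel (\<lambda>x. \<gamma> * sqrt t + x)) u = exp (of_real t * \<Psi> (1 / sqrt t * u))" .
    qed (use t in auto)
    then have "abs_moment M (\<lambda>\<omega>. (1 / sqrt t) * X t \<omega>) q = abs_moment ?N (\<lambda>x. \<gamma> * sqrt t + x) q"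
      using abs_moment_distr[of "\<lambda>\<omega>. (1 / sqrt t) * X t \<omega>" M q] abs_moment_distr[of "\<lambda>x. \<gamma> * sqrt t + x" ?N q]
      by simp
    moreover have "ennreal (\<bar>(1 / sqrt t) * X t \<omega>\<bar> powr q) = ennreal (t powr (-(q/2))) * ennreal (\<bar>X t \<omega>\<bar> powr q)" for \<omega>
      using t by (simp add: powr_divide powr_minus_divide powr_half_sqrt[symmetric] powr_powr flip: ennreal_mult')
    ultimately show ?thesis by (simp add: abs_moment_def nn_integral_cmult)
  qed
  have "((\<lambda>t. abs_moment ?N (\<lambda>x. \<gamma> * sqrt t + x) q) \<longlongrightarrow> abs_moment ?N (\<lambda>x. x) q) (at_right 0)"
  proof (rule tendsto_at_right_sequentially[of 0 1])
    fix S :: "nat \<Rightarrow> real" assume S: "\<And>n. 0 < S n" "\<And>n. S n < 1" "S \<longlonglongrightarrow> 0"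
    show "(\<lambda>n. abs_moment ?N (\<lambda>x. \<gamma> * sqrt (S n) + x) q) \<longlonglongrightarrow> abs_moment ?N (\<lambda>x. x) q"
      unfolding abs_moment_def
    proof (rule nn_integral_dominated_convergence[where w = "\<lambda>x. ennreal ((\<bar>\<bar>\<gamma>\<bar> + 1\<bar> + \<bar>x\<bar>) ^ (2 * n))"])
      fix j
      have "\<bar>\<gamma> * sqrt (S j) + x\<bar> powr q \<le> (\<bar>\<bar>\<gamma>\<bar> + 1\<bar> + \<bar>x\<bar>) ^ (2 * n)" for x
      proof -
        define y where "y = \<bar>\<bar>\<gamma>\<bar> + 1\<bar> + \<bar>x\<bar>"
        have y: "1 \<le> y" by (simp add: y_def)
        have "\<bar>\<gamma> * sqrt (S j)\<bar> \<le> \<bar>\<gamma>\<bar> * 1" unfolding abs_mult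
          using S(1,2)[of j] by (intro mult_left_mono) auto
        then have "\<bar>\<gamma> * sqrt (S j) + x\<bar> powr q \<le> y powr q"
          using q by (intro powr_mono2) (auto simp: y_def)
        also have "\<dots> \<le> y powr real (2 * n)" using y n by (intro powr_mono) auto
        also have "\<dots> = y ^ (2 * n)" using y by (simp only: powr_realpow)
        finally show ?thesis by (simp add: y_def)
      qed
      then show "AE x in ?N. ennreal (\<bar>\<gamma> * sqrt (S j) + x\<bar> powr q) \<le> ennreal ((\<bar>\<bar>\<gamma>\<bar> + 1\<bar> + \<bar>x\<bar>) ^ (2 * n))"
        by (intro AE_I2 ennreal_leI)
    next
      have "(\<lambda>j. ennreal (\<bar>\<gamma> * sqrt (S j) + x\<bar> powr q)) \<longlonglongrightarrow> ennreal (\<bar>\<gamma> * sqrt 0 + x\<bar> powr q)" for x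
        by (intro tendsto_ennrealI tendsto_powr' tendsto_intros S) (use q in auto)
      then show "AE x in ?N. (\<lambda>j. ennreal (\<bar>\<gamma> * sqrt (S j) + x\<bar> powr q)) \<longlonglongrightarrow> ennreal (\<bar>x\<bar> powr q)"
        by simp
    qed (use normal_moment_dominated[OF \<sigma>, of "\<bar>\<gamma>\<bar> + 1" n] in auto)
  qed simp
  moreover have "\<forall>\<^sub>F t in at_right 0. abs_moment ?N (\<lambda>x. \<gamma> * sqrt t + x) q =
      ennreal (t powr (-(q/2))) * abs_moment M (X t) q"
    using eventually_at_right_less[of "0::real"] by eventually_elim (simp add: eq)
  ultimately show ?thesis unfolding normal_abs_moment_def by (rule Lim_transform_eventually)
qed

end

section \<open>The small-time limits\<close>

context levy_marginals begin

lemma moment_at_0: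
  shows "abs_moment M (X 0) q = 0"
proof -
  note X_measurable[OF order_refl, measurable]
  have "distr M borel (\<lambda>\<omega>. 1 * X 0 \<omega>) = return borel 0"
    by (rule distr_X_eqI[OF order_refl real_distribution_return]) (simp add: char_return)
  then have "abs_moment M (X 0) q = abs_moment (return borel 0) (\<lambda>x. x) q"
    using abs_moment_distr[of "X 0" M q] by simp
  also have "\<dots> = 0" unfolding abs_moment_def by (subst nn_integral_return) auto
  finally show ?thesis .
qed

text \<open>For \<open>s = 0\<close> the moment vanishes because \<open>X 0 = 0\<close> almost surely, and the limit vanishes because
  \<open>0 powr p = 0\<close>.\<close>

lemma moment_tendsto_time_scale:
  assumes s: "0 \<le> s"
    and lim: "((\<lambda>t. ennreal (t powr (-p)) * abs_moment M (X t) q) \<longlongrightarrow> L) (at_right 0)"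
  shows "((\<lambda>t. ennreal (t powr (-p)) * abs_moment M (X (t * s)) q) \<longlongrightarrow> ennreal (s powr p) * L) (at_right 0)"
proof (cases "s = 0")
  case True
  then show ?thesis by (simp add: moment_at_0)
next
  case False
  then have s: "0 < s" using s by simp
  have "filterlim (\<lambda>t. t * s) (at_right 0) (at_right 0)" using s by real_asymp
  from filterlim_compose[OF lim this]
  have "((\<lambda>t. ennreal (s powr p) * (ennreal ((t * s) powr (-p)) * abs_moment M (X (t * s)) q)) \<longlongrightarrow>
      ennreal (s powr p) * L) (at_right 0)"
    by (rule ennreal_tendsto_cmult[rotated]) simp
  moreover have "\<forall>\<^sub>F t in at_right 0. ennreal (s powr p) * (ennreal ((t * s) powr (-p)) * abs_moment M (X (t * s)) q) =
      ennreal (t powr (-p)) * abs_moment M (X (t * s)) q"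
    using eventually_at_right_less[of "0::real"]
  proof eventually_elim
    case (elim t)
    have "s powr p * (t * s) powr (-p) = t powr (-p)"
      using s elim by (simp add: powr_mult powr_minus_divide)
    then have "ennreal (s powr p) * ennreal ((t * s) powr (-p)) = ennreal (t powr (-p))"
      by (simp flip: ennreal_mult')
    then show ?case by (metis mult.assoc)
  qed
  ultimately show ?thesis by (rule Lim_transform_eventually)
qed

lemma moment_div_tendsto_time_scale:
  assumes s: "0 \<le> s"
    and lim: "((\<lambda>t. ennreal (1 / t) * abs_moment M (X t) q) \<longlongrightarrow> L) (at_right 0)"
  shows "((\<lambda>t. ennreal (1 / t) * abs_moment M (X (t * s)) q) \<longlongrightarrow> ennreal s * L) (at_right 0)"
proof -
  have e: "\<forall>\<^sub>F t in at_right 0. ennreal (1 / t) * f t = ennreal (t powr (-1)) * f t" for f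
    using eventually_at_right_less[of "0::real"] by eventually_elim (simp add: powr_minus_divide)
  have "((\<lambda>t. ennreal (t powr (-1)) * abs_moment M (X t) q) \<longlongrightarrow> L) (at_right 0)"
    by (rule Lim_transform_eventually[OF lim e])
  from moment_tendsto_time_scale[OF s this]
  have "((\<lambda>t. ennreal (t powr (-1)) * abs_moment M (X (t * s)) q) \<longlongrightarrow> ennreal s * L) (at_right 0)"
    using s by simp
  then show ?thesis
    by (rule Lim_transform_eventually[OF _ eventually_mono[OF e sym]])
qed

text \<open>Without Gaussian part \<open>\<Psi>\<close> grows like \<open>u powr p\<close> for some \<open>p\<close> between \<open>max 1 (index_zero \<nu>)\<close> and \<open>q\<close>. The growth bound
  needs \<open>p \<le> 2\<close>, hence the minimum with 2.\<close>

lemma moment_tendsto_pure_jump: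
  assumes \<sigma>: "\<sigma> = 0" and q: "q \<in> index_interval \<nu>" "1 < q"
  shows "((\<lambda>t. ennreal (1 / t) * abs_moment M (X t) q) \<longlongrightarrow> (\<integral>\<^sup>+x. ennreal (\<bar>x\<bar> powr q) \<partial>\<nu>)) (at_right 0)"
proof -
  have I: "index_zero \<nu> < ereal q" "ereal q < index_infinity \<nu>"
    using q by (auto simp: index_interval_def)
  obtain r where r: "q < r" "large_moment r"
    using index_infinity_large_moment[OF I(2), of "q + 1"] by auto
  obtain p where p: "1 < p" "p < q" "small_moment p"
    using index_zero_small_moment[OF I(1) q(2)] by auto
  have "small_moment (min p 2)" using p small_moment_2 by (simp add: min_def)
  then obtain C where C: "\<And>u. 1 \<le> u \<Longrightarrow> cmod (\<Psi> u) \<le> C * u powr (min p 2)"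
    using exponent_growth[of "min p 2"] p \<sigma> by auto
  show ?thesis
    by (rule moment_div_tendsto_jump_moment[OF _ _ r C]) (use p in auto)
qed

lemma moment_tendsto_pure_jump_driftless:
  assumes \<sigma>: "\<sigma> = 0" and drift: "levy_drift \<gamma> \<nu> = 0" and q: "q \<in> index_interval \<nu>" "q \<le> 1"
  shows "((\<lambda>t. ennreal (1 / t) * abs_moment M (X t) q) \<longlongrightarrow> (\<integral>\<^sup>+x. ennreal (\<bar>x\<bar> powr q) \<partial>\<nu>)) (at_right 0)"
proof -
  have I: "index_zero \<nu> < ereal q" "ereal q < index_infinity \<nu>"
    using q by (auto simp: index_interval_def)
  have q0: "0 < q" by (rule index_interval_pos[OF q(1)])
  obtain r where r: "q < r" "large_moment r"
    using index_infinity_large_moment[OF I(2), of "q + 1"] by auto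
  obtain p where p: "0 < p" "p < q" "small_moment p"
    using index_zero_small_moment[OF I(1) q0] by auto
  obtain C where C: "\<And>u. 1 \<le> u \<Longrightarrow> cmod (\<Psi> u - \<i> * of_real (levy_drift \<gamma> \<nu> * u)) \<le> C * u powr p"
    using exponent_minus_drift_growth[of p] p q \<sigma> by auto
  show ?thesis
    by (rule moment_div_tendsto_jump_moment[OF q0 p(2) r, of C]) (use C drift in auto)
qed

text \<open>For \<open>q > 2\<close> the quadratic growth that every exponent has is already slow enough.\<close>

lemma moment_tendsto_above_2:
  assumes q: "q \<in> index_interval \<nu>" "2 < q"
  shows "((\<lambda>t. ennreal (1 / t) * abs_moment M (X t) q) \<longlongrightarrow> (\<integral>\<^sup>+x. ennreal (\<bar>x\<bar> powr q) \<partial>\<nu>)) (at_right 0)"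
proof -
  have I: "ereal q < index_infinity \<nu>"
    using q by (auto simp: index_interval_def)
  obtain r where r: "q < r" "large_moment r"
    using index_infinity_large_moment[OF I, of "q + 1"] by auto
  obtain C where C: "\<And>u. 1 \<le> u \<Longrightarrow> cmod (\<Psi> u) \<le> C * u powr 2"
    using exponent_growth[of 2] small_moment_2 by auto
  show ?thesis
    by (rule moment_div_tendsto_jump_moment[OF _ q(2) r C]) (use q in auto)
qed

end

lemma levy_process_marginals:
  assumes "levy_process M X" "characteristic_triplet M X \<gamma> \<sigma> \<nu>"
  shows "levy_marginals \<gamma> \<sigma> \<nu> M X"
proof -
  interpret levy_process M X by fact
  show ?thesis
    by unfold_locales (use assms(2) random_variable in \<open>auto simp: characteristic_triplet_def\<close>)
qed

theorem lemma4p2: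
  fixes M :: "'a measure" and X :: "real \<Rightarrow> 'a \<Rightarrow> real"
    and \<gamma> \<sigma> s :: real and \<nu> :: "real measure"
  assumes "levy_process M X"
    and "characteristic_triplet M X \<gamma> \<sigma> \<nu>"
    and "index_zero \<nu> < index_infinity \<nu>"
    and "s \<ge> 0"
  shows
    "(\<sigma> = 0 \<and> \<nu> = null_measure borel \<longrightarrow>
       (\<forall>q \<in> index_interval \<nu>.
          ((\<lambda>t. ennreal (t powr (-q)) * abs_moment M (X (t * s)) q)
             \<longlongrightarrow> ennreal (s powr q * \<bar>\<gamma>\<bar> powr q)) (at_right 0))) \<and>
     (\<sigma> \<noteq> 0 \<and> \<nu> = null_measure borel \<longrightarrow>
       (\<forall>q \<in> index_interval \<nu>.
          ((\<lambda>t. ennreal (t powr (-(q / 2))) * abs_moment M (X (t * s)) q)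
             \<longlongrightarrow> ennreal (s powr (q / 2)) * normal_abs_moment \<sigma> q) (at_right 0))) \<and>
     (\<sigma> = 0 \<and> \<nu> \<noteq> null_measure borel \<longrightarrow>
       (\<forall>q \<in> index_interval \<nu> \<inter> {1<..}.
          ((\<lambda>t. ennreal (1 / t) * abs_moment M (X (t * s)) q)
             \<longlongrightarrow> ennreal s * (\<integral>\<^sup>+x. ennreal (\<bar>x\<bar> powr q) \<partial>\<nu>)) (at_right 0)) \<and>
       (index_zero \<nu> < 1 \<longrightarrow>
         (levy_drift \<gamma> \<nu> = 0 \<longrightarrow>
           (\<forall>q \<in> index_interval \<nu> \<inter> {..1}.
              ((\<lambda>t. ennreal (1 / t) * abs_moment M (X (t * s)) q)
                 \<longlongrightarrow> ennreal s * (\<integral>\<^sup>+x. ennreal (\<bar>x\<bar> powr q) \<partial>\<nu>)) (at_right 0))) \<and>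
         (levy_drift \<gamma> \<nu> \<noteq> 0 \<longrightarrow>
           (\<forall>q \<in> index_interval \<nu> \<inter> {0<..<1}.
              ((\<lambda>t. ennreal (t powr (-q)) * abs_moment M (X (t * s)) q)
                 \<longlongrightarrow> ennreal (s powr q * \<bar>levy_drift \<gamma> \<nu>\<bar> powr q)) (at_right 0))))) \<and>
     (\<sigma> \<noteq> 0 \<and> \<nu> \<noteq> null_measure borel \<longrightarrow>
       (\<forall>q \<in> index_interval \<nu> \<inter> {2<..}.
          ((\<lambda>t. ennreal (1 / t) * abs_moment M (X (t * s)) q)
             \<longlongrightarrow> ennreal s * (\<integral>\<^sup>+x. ennreal (\<bar>x\<bar> powr q) \<partial>\<nu>)) (at_right 0)) \<and>
       (2 \<in> index_interval \<nu> \<longrightarrow>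
          ((\<lambda>t. ennreal (1 / t) * abs_moment M (X (t * s)) 2)
             \<longlongrightarrow> ennreal (s * \<sigma>\<^sup>2) + ennreal s * (\<integral>\<^sup>+x. ennreal (\<bar>x\<bar> powr 2) \<partial>\<nu>)) (at_right 0)) \<and>
       (\<forall>q \<in> index_interval \<nu> \<inter> {0<..<2}.
          ((\<lambda>t. ennreal (t powr (-(q / 2))) * abs_moment M (X (t * s)) q)
             \<longlongrightarrow> ennreal (s powr (q / 2)) * normal_abs_moment \<sigma> q) (at_right 0)))"
proof (intro conjI impI ballI; (elim conjE)?)
  interpret levy_marginals \<gamma> \<sigma> \<nu> M X using levy_process_marginals[OF assms(1,2)] .
  note scale = moment_tendsto_time_scale[OF assms(4)]
  note div_scale = moment_div_tendsto_time_scale[OF assms(4)]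
  have \<sigma>: "0 < \<sigma>" if "\<sigma> \<noteq> 0" using that assms(2) by (simp add: characteristic_triplet_def)
  {
    fix q assume "\<sigma> = 0" "\<nu> = null_measure borel"
    from scale[OF moment_tendsto_deterministic[OF this]]
    show "((\<lambda>t. ennreal (t powr (-q)) * abs_moment M (X (t * s)) q)
        \<longlongrightarrow> ennreal (s powr q * \<bar>\<gamma>\<bar> powr q)) (at_right 0)"
      by (simp add: ennreal_mult')
  next
    fix q assume "\<sigma> \<noteq> 0" "\<nu> = null_measure borel" "q \<in> index_interval \<nu>"
    then show "((\<lambda>t. ennreal (t powr (-(q / 2))) * abs_moment M (X (t * s)) q)
             \<longlongrightarrow> ennreal (s powr (q / 2)) * normal_abs_moment \<sigma> q) (at_right 0)"
      by (intro scale moment_tendsto_brownian \<sigma> index_interval_pos)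
  next
    fix q assume "\<sigma> = 0" "q \<in> index_interval \<nu> \<inter> {1<..}"
    then show "((\<lambda>t. ennreal (1 / t) * abs_moment M (X (t * s)) q)
             \<longlongrightarrow> ennreal s * (\<integral>\<^sup>+x. ennreal (\<bar>x\<bar> powr q) \<partial>\<nu>)) (at_right 0)"
      by (intro div_scale moment_tendsto_pure_jump) auto
  next
    fix q assume "\<sigma> = 0" "levy_drift \<gamma> \<nu> = 0" "q \<in> index_interval \<nu> \<inter> {..1}"
    then show "((\<lambda>t. ennreal (1 / t) * abs_moment M (X (t * s)) q)
             \<longlongrightarrow> ennreal s * (\<integral>\<^sup>+x. ennreal (\<bar>x\<bar> powr q) \<partial>\<nu>)) (at_right 0)"
      by (intro div_scale moment_tendsto_pure_jump_driftless) auto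
  next
    fix q assume "\<sigma> = 0" and q: "q \<in> index_interval \<nu> \<inter> {0<..<1}"
    have I: "index_zero \<nu> < ereal q" "ereal q < index_infinity \<nu>"
      using q by (auto simp: index_interval_def)
    obtain p where p: "p < q" "small_moment p" using index_zero_small_moment[OF I(1), of 0] q by auto
    obtain r where r: "q < r" "r < 1" "large_moment r" using index_infinity_large_moment[OF I(2), of 1] q by auto
    have "small_moment r" using small_moment_mono p r by fastforce
    with r q \<open>\<sigma> = 0\<close> scale[OF moment_tendsto_drift[of q r]]
    show "((\<lambda>t. ennreal (t powr (-q)) * abs_moment M (X (t * s)) q)
                 \<longlongrightarrow> ennreal (s powr q * \<bar>levy_drift \<gamma> \<nu>\<bar> powr q)) (at_right 0)"
      by (simp add: ennreal_mult')
  next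
    fix q assume "q \<in> index_interval \<nu> \<inter> {2<..}"
    then show "((\<lambda>t. ennreal (1 / t) * abs_moment M (X (t * s)) q)
             \<longlongrightarrow> ennreal s * (\<integral>\<^sup>+x. ennreal (\<bar>x\<bar> powr q) \<partial>\<nu>)) (at_right 0)"
      by (intro div_scale moment_tendsto_above_2) auto
  next
    assume "2 \<in> index_interval \<nu>"
    then have "ereal 2 < index_infinity \<nu>" by (simp add: index_interval_def)
    then obtain r where "2 < r" "large_moment r" by (rule index_infinity_large_moment[of 2 3]) auto
    then have "large_moment 2" by (auto intro: large_moment_antimono)
    from div_scale[OF second_moment_div_tendsto[OF this]]
    show "((\<lambda>t. ennreal (1 / t) * abs_moment M (X (t * s)) 2)
             \<longlongrightarrow> ennreal (s * \<sigma>\<^sup>2) + ennreal s * (\<integral>\<^sup>+x. ennreal (\<bar>x\<bar> powr 2) \<partial>\<nu>)) (at_right 0)"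
      using assms(4) by (simp only: distrib_left ennreal_mult')
  next
    fix q assume "\<sigma> \<noteq> 0" and q: "q \<in> index_interval \<nu> \<inter> {0<..<2}"
    have I: "ereal q < index_infinity \<nu>"
      using q by (auto simp: index_interval_def)
    obtain r where r: "q < r" "r < 2" "large_moment r" using index_infinity_large_moment[OF I, of 2] q by auto
    show "((\<lambda>t. ennreal (t powr (-(q / 2))) * abs_moment M (X (t * s)) q)
             \<longlongrightarrow> ennreal (s powr (q / 2)) * normal_abs_moment \<sigma> q) (at_right 0)"
      by (intro scale moment_tendsto_gaussian[OF \<sigma> _ r(1) _ r(3)]) (use r q \<open>\<sigma> \<noteq> 0\<close> in auto)
  }
qed

end
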